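(* Let $\Gamma$ be a countable group with a finite symmetric subset $S$. Let $H_1\subset \Gamma$ be a (deterministic) co-amenable subgroup and let $H_2$ be an ergodic invariant random subgroup of $\Gamma$. Then, almost surely, \[ \rho(\Gamma/ (H_1\cap H_2))=\rho(\Gamma/ H_2),\] where $\rho$ denotes the co-spectral radius with respect to $S$.
   Context: For a finite symmetric subset $S\subset\Gamma$ and a subgroup $H\subset \Gamma$, the co-spectral radius of $H$ (with respect to $S$) is the operator norm $\rho(\Gamma/H):=\|M\|$ of the operator $M\colon L^2(\Gamma/H)\to L^2(\Gamma/H)$ ($\Gamma/H$ carries counting measure) given by \[ M\phi(\gamma H)=\frac{1}{|S|}\sum_{s\in S}\phi(s\gamma H).\] A subgroup $H$ is called co-amenable in $\Gamma$ if its co-spectral radius equals $1$ for every choice of the finite symmetric subset $S$. Let $\mathrm{Sub}_\Gamma$ be the space of subgroups of $\Gamma$ with the topology induced from $\{0,1\}^\Gamma$. An invariant random subgroup (IRS) of $\Gamma$ is a random subgroup whose distribution is a Borel probability measure on $\mathrm{Sub}_\Gamma$ invariant under conjugation by $\Gamma$; it is ergodic if this measure is ergodic for the conjugation action. The function $H\mapsto\rho(\Gamma/H)$ is measurable and conjugation invariant, so it is almost surely constant for an ergodic IRS; $\rho(\Gamma/H_2)$ denotes this constant. *)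

theory Defs
  imports "HOL-Probability.Probability" "HOL-Algebra.Left_Coset"
begin

section \<open>Co-spectral radius and co-amenability\<close>

text \<open>
  Nonemptiness is implicit in the normalisation by \<open>1 / card S\<close>.  It cannot be dropped: for
  \<open>S = {}\<close> HOL reads the averaging operator as 0, so no subgroup would be co-amenable.
\<close>
definition finite_symmetric_subset :: "('a, 'b) monoid_scheme \<Rightarrow> 'a set \<Rightarrow> bool" where
  "finite_symmetric_subset G S \<longleftrightarrow>
     finite S \<and> S \<noteq> {} \<and> S \<subseteq> carrier G \<and> (\<forall>s\<in>S. inv\<^bsub>G\<^esub> s \<in> S)"

text \<open>
  The space of square-summable complex functions on a set \<open>X\<close> with counting measure. Elements are
  represented by functions on the whole type; values outside \<open>X\<close> are irrelevant.
\<close>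
definition ell2 :: "'x set \<Rightarrow> ('x \<Rightarrow> complex) set" where
  "ell2 X = {\<phi>. (\<lambda>x. (cmod (\<phi> x))\<^sup>2) summable_on X}"

definition ell2_norm :: "'x set \<Rightarrow> ('x \<Rightarrow> complex) \<Rightarrow> real" where
  "ell2_norm X \<phi> = sqrt (\<Sum>\<^sub>\<infinity>x\<in>X. (cmod (\<phi> x))\<^sup>2)"

text \<open>
  On left cosets \<open>C = \<gamma>H\<close> the translate \<open>s\<gamma>H\<close> is \<open>s <# C\<close>, so the formula does not mention \<open>H\<close>.
\<close>
definition averaging_operator ::
    "('a, 'b) monoid_scheme \<Rightarrow> 'a set \<Rightarrow> ('a set \<Rightarrow> complex) \<Rightarrow> 'a set \<Rightarrow> complex" where
  "averaging_operator G S \<phi> C = 1 / of_nat (card S) * (\<Sum>s\<in>S. \<phi> (s <#\<^bsub>G\<^esub> C))"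

definition cospectral_radius :: "('a, 'b) monoid_scheme \<Rightarrow> 'a set \<Rightarrow> 'a set \<Rightarrow> real" where
  "cospectral_radius G S H =
     (SUP \<phi> \<in> {\<phi> \<in> ell2 (lcosets\<^bsub>G\<^esub> H). ell2_norm (lcosets\<^bsub>G\<^esub> H) \<phi> \<le> 1}.
        ell2_norm (lcosets\<^bsub>G\<^esub> H) (averaging_operator G S \<phi>))"

definition coamenable :: "('a, 'b) monoid_scheme \<Rightarrow> 'a set \<Rightarrow> bool" where
  "coamenable G H \<longleftrightarrow> (\<forall>S. finite_symmetric_subset G S \<longrightarrow> cospectral_radius G S H = 1)"

section \<open>Invariant random subgroups\<close>

text \<open>
  The topology that the set of subgroups inherits from \<open>{0,1}\<^sup>\<Gamma>\<close>, a subgroup being identified with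
  its indicator function.
\<close>
definition subgroup_topology :: "('a, 'b) monoid_scheme \<Rightarrow> 'a set topology" where
  "subgroup_topology G =
     pullback_topology {H. subgroup H G} (\<lambda>H. \<lambda>g\<in>carrier G. g \<in> H)
       (product_topology (\<lambda>_. discrete_topology (UNIV :: bool set)) (carrier G))"

definition subgroup_borel :: "('a, 'b) monoid_scheme \<Rightarrow> 'a set measure" where
  "subgroup_borel G = sigma {H. subgroup H G} {U. openin (subgroup_topology G) U}"

definition conjugate_subgroup :: "('a, 'b) monoid_scheme \<Rightarrow> 'a \<Rightarrow> 'a set \<Rightarrow> 'a set" where
  "conjugate_subgroup G g H = g <#\<^bsub>G\<^esub> H #>\<^bsub>G\<^esub> inv\<^bsub>G\<^esub> g"

definition conjugation_invariant_measure ::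
    "('a, 'b) monoid_scheme \<Rightarrow> 'a set measure \<Rightarrow> bool" where
  "conjugation_invariant_measure G \<mu> \<longleftrightarrow>
     (\<forall>g\<in>carrier G. distr \<mu> (subgroup_borel G) (conjugate_subgroup G g) = \<mu>)"

definition conjugation_ergodic_measure ::
    "('a, 'b) monoid_scheme \<Rightarrow> 'a set measure \<Rightarrow> bool" where
  "conjugation_ergodic_measure G \<mu> \<longleftrightarrow>
     (\<forall>A\<in>sets \<mu>. (\<forall>g\<in>carrier G. conjugate_subgroup G g -` A \<inter> space \<mu> = A) \<longrightarrow>
        measure \<mu> A = 0 \<or> measure \<mu> A = 1)"

abbreviation subgroup_law ::
    "('a, 'b) monoid_scheme \<Rightarrow> 'w measure \<Rightarrow> ('w \<Rightarrow> 'a set) \<Rightarrow> 'a set measure" where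
  "subgroup_law G P H \<equiv> distr P (subgroup_borel G) H"

definition invariant_random_subgroup ::
    "('a, 'b) monoid_scheme \<Rightarrow> 'w measure \<Rightarrow> ('w \<Rightarrow> 'a set) \<Rightarrow> bool" where
  "invariant_random_subgroup G P H \<longleftrightarrow>
     prob_space P \<and> H \<in> measurable P (subgroup_borel G) \<and>
     conjugation_invariant_measure G (subgroup_law G P H)"

definition ergodic_invariant_random_subgroup ::
    "('a, 'b) monoid_scheme \<Rightarrow> 'w measure \<Rightarrow> ('w \<Rightarrow> 'a set) \<Rightarrow> bool" where
  "ergodic_invariant_random_subgroup G P H \<longleftrightarrow>
     invariant_random_subgroup G P H \<and> conjugation_ergodic_measure G (subgroup_law G P H)"

text \<open>
  The almost sure value of the co-spectral radius of a random subgroup. It exists for an ergodic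
  invariant random subgroup of a countable group, the co-spectral radius being a measurable
  conjugation invariant function, and it is unique because \<open>P\<close> is a probability measure.
\<close>
definition irs_cospectral_radius ::
    "('a, 'b) monoid_scheme \<Rightarrow> 'a set \<Rightarrow> 'w measure \<Rightarrow> ('w \<Rightarrow> 'a set) \<Rightarrow> real" where
  "irs_cospectral_radius G S P H = (THE c. AE \<omega> in P. cospectral_radius G S (H \<omega>) = c)"

end

theory Submission
  imports Defs
begin

text \<open>
  One inequality holds for every subgroup: \<open>\<Gamma>/(H1 \<inter> H2)\<close> maps equivariantly onto \<open>\<Gamma>/H2\<close>, and taking
  \<open>\<ell>\<^sup>2\<close>-norms on the fibres does not decrease the norm of an average (\<open>averaging_bound_pullback\<close>).

  For the other one, consider the diagonal action on \<open>\<Gamma>/H1 \<times> \<Gamma>/H2\<close>, whose orbits are the spaces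
  \<open>\<Gamma>/(H1\<^sup>x \<inter> H2\<^sup>y)\<close> for conjugates \<open>H1\<^sup>x\<close> and \<open>H2\<^sup>y\<close>. Co-amenability of \<open>H1\<close> provides
  finitely supported probability measures \<open>\<nu>\<close> on \<open>\<Gamma>/H1\<close> that are almost invariant (\<open>coamenable_almost_invariant\<close>). Tensoring
  \<open>sqrt \<nu>\<close> with a vector \<open>\<phi>\<close> on \<open>\<Gamma>/H2\<close> that is almost extremal for the averaging operator shows that the
  product has at least the norm \<open>\<rho>(\<Gamma>/H2)\<close>. This alone finds \<open>\<rho>(\<Gamma>/H2)\<close> only as the supremum over
  all orbits, that is, over all conjugates of \<open>H2\<close>, and not for \<open>H1 \<inter> H2\<close> itself.

  The stronger conclusion uses that \<open>H2\<close> is random with a conjugation invariant law. Let \<open>t\<close> be less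
  than the almost sure value of \<open>\<rho>(\<Gamma>/H2)\<close>. The orbits in the product on which averaging has norm at
  most \<open>t\<close> form an invariant set \<open>B\<close>, so the tensor vector may be restricted to \<open>B\<close> before
  averaging. Over a point of \<open>\<Gamma>/H2\<close> the slice of \<open>B\<close> has a \<open>\<nu>\<close>-mass that hardly depends on the point,
  because \<open>\<nu>\<close> is almost invariant. If this mass stayed away from 0, the restricted vector would be as
  extremal as \<open>\<phi>\<close>, contradicting the bound \<open>t\<close> on \<open>B\<close>. So the mass tends to 0 for almost every value
  of \<open>H2\<close> (\<open>bounded_mass_bound\<close>). But by invariance of the law its expectation is, for every \<open>\<nu>\<close>, the
  probability that \<open>\<rho>(\<Gamma>/(H1 \<inter> H2)) \<le> t\<close>, which is therefore 0 (\<open>AE_cospectral_radius_Int_gt\<close>).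
  Ergodicity is needed for the almost sure value of \<open>\<rho>(\<Gamma>/H2)\<close> to exist, and measurability comes from
  lower semicontinuity of the co-spectral radius.
\<close>

(* Below, this infix always denotes a left coset. *)
no_notation (ASCII) subset_mset (infix "<#" 50)

section \<open>Averages over a finite set of maps\<close>

lemma L2_set_sum_le:
  assumes "finite I"
  shows "L2_set (\<lambda>x. \<Sum>i\<in>I. f i x) A \<le> (\<Sum>i\<in>I. L2_set (f i) A)"
  using assms
proof (induction I rule: finite_induct)
  case empty
  then show ?case by (simp add: L2_set_def)
next
  case (insert i I)
  have "L2_set (\<lambda>x. \<Sum>j\<in>insert i I. f j x) A = L2_set (\<lambda>x. f i x + (\<Sum>j\<in>I. f j x)) A"
    using insert by simp
  also have "\<dots> \<le> L2_set (f i) A + L2_set (\<lambda>x. \<Sum>j\<in>I. f j x) A"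
    by (rule L2_set_triangle_ineq)
  finally show ?case using insert by simp
qed

lemma L2_set_square: "(L2_set f A)\<^sup>2 = (\<Sum>x\<in>A. (f x)\<^sup>2)"
  by (simp add: L2_set_def sum_nonneg)

text \<open>
  Up to the factor \<open>card S\<close> this says that averaging over \<open>S\<close> has norm at most \<open>t\<close> on \<open>\<ell>\<^sup>2(X)\<close>. Only finite
  sums of nonnegative functions occur: the operator has nonnegative coefficients, so these
  determine its norm. The right-hand sum runs over the points at which \<open>\<phi>\<close> is read on the left,
  so \<open>\<phi>\<close> needs no support condition and \<open>X\<close> need not be closed under the action.
\<close>
definition averaging_bound ::
    "'a set \<Rightarrow> ('a \<Rightarrow> 'x \<Rightarrow> 'x) \<Rightarrow> 'x set \<Rightarrow> real \<Rightarrow> bool" where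
  "averaging_bound S act X t \<longleftrightarrow>
     (\<forall>Y \<phi>. finite Y \<and> Y \<subseteq> X \<and> (\<forall>x. 0 \<le> \<phi> x) \<longrightarrow>
        (\<Sum>x\<in>Y. (\<Sum>s\<in>S. \<phi> (act s x))\<^sup>2)
          \<le> (t * real (card S))\<^sup>2 * (\<Sum>z\<in>(\<Union>s\<in>S. act s ` Y). (\<phi> z)\<^sup>2))"

lemma averaging_boundD:
  assumes "averaging_bound S act X t" "finite Y" "Y \<subseteq> X" "\<And>x. 0 \<le> \<phi> x"
  shows "(\<Sum>x\<in>Y. (\<Sum>s\<in>S. \<phi> (act s x))\<^sup>2)
          \<le> (t * real (card S))\<^sup>2 * (\<Sum>z\<in>(\<Union>s\<in>S. act s ` Y). (\<phi> z)\<^sup>2)"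
  using assms unfolding averaging_bound_def by blast

text \<open>
  A test function \<open>\<phi>\<close> on \<open>X\<close> is pushed to \<open>X'\<close> by taking its \<open>\<ell>\<^sup>2\<close>-norm on each fibre of \<open>\<theta>\<close>. This keeps
  the norm, and by the triangle inequality on the fibres it does not decrease the norm of the
  average. Monotonicity in the subgroup, invariance under conjugation, semicontinuity, and the passage
  from orbits to coset spaces are all obtained by a suitable choice of \<open>\<theta>\<close>.
\<close>
lemma averaging_bound_pullback:
  fixes act :: "'a \<Rightarrow> 'x \<Rightarrow> 'x" and act' :: "'a \<Rightarrow> 'y \<Rightarrow> 'y"
  assumes bound: "averaging_bound S act' X' t" and S: "finite S"
    and into: "\<theta> ` X \<subseteq> X'" and inj: "\<And>s. s \<in> S \<Longrightarrow> inj_on (act s) X"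
    and equi: "\<And>s x. s \<in> S \<Longrightarrow> x \<in> X \<Longrightarrow> \<theta> (act s x) = act' s (\<theta> x)"
  shows "averaging_bound S act X t"
  unfolding averaging_bound_def
proof (intro allI impI, elim conjE)
  fix Y and \<phi> :: "'x \<Rightarrow> real"
  assume Y: "finite Y" "Y \<subseteq> X" and pos: "\<forall>x. 0 \<le> \<phi> x"
  define W where "W = (\<Union>s\<in>S. act s ` Y)"
  define \<psi> where "\<psi> y = L2_set \<phi> {z \<in> W. \<theta> z = y}" for y
  have W: "finite W" using S Y by (simp add: W_def)
  have image: "(\<Union>s\<in>S. act' s ` \<theta> ` Y) = \<theta> ` W"
    unfolding W_def image_UN image_image using equi Y(2) by (intro SUP_cong image_cong) auto
  have fibre: "(\<Sum>x | x \<in> Y \<and> \<theta> x = y. (\<Sum>s\<in>S. \<phi> (act s x))\<^sup>2) \<le> (\<Sum>s\<in>S. \<psi> (act' s y))\<^sup>2"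
    if y: "y \<in> \<theta> ` Y" for y
  proof -
    let ?Y = "{x \<in> Y. \<theta> x = y}"
    have "L2_set (\<lambda>x. \<phi> (act s x)) ?Y \<le> \<psi> (act' s y)" if s: "s \<in> S" for s
    proof -
      have "inj_on (act s) ?Y" using inj[OF s] Y(2) by (auto intro: inj_on_subset)
      then have "(\<Sum>x\<in>?Y. (\<phi> (act s x))\<^sup>2) = (\<Sum>z\<in>act s ` ?Y. (\<phi> z)\<^sup>2)"
        by (simp add: sum.reindex)
      also have "\<dots> \<le> (\<Sum>z | z \<in> W \<and> \<theta> z = act' s y. (\<phi> z)\<^sup>2)"
        using s Y(2) equi finite_subset[OF _ W, of "{z \<in> W. \<theta> z = act' s y}"]
        by (intro sum_mono2) (auto simp: W_def)
      finally show ?thesis by (simp add: \<psi>_def L2_set_def)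
    qed
    then have "(\<Sum>s\<in>S. L2_set (\<lambda>x. \<phi> (act s x)) ?Y) \<le> (\<Sum>s\<in>S. \<psi> (act' s y))"
      by (rule sum_mono)
    then have "L2_set (\<lambda>x. \<Sum>s\<in>S. \<phi> (act s x)) ?Y \<le> (\<Sum>s\<in>S. \<psi> (act' s y))"
      using L2_set_sum_le[OF S, of "\<lambda>s x. \<phi> (act s x)" ?Y] by linarith
    then have "(L2_set (\<lambda>x. \<Sum>s\<in>S. \<phi> (act s x)) ?Y)\<^sup>2 \<le> (\<Sum>s\<in>S. \<psi> (act' s y))\<^sup>2"
      by (rule power_mono) (simp add: L2_set_nonneg)
    then show ?thesis by (simp add: L2_set_square)
  qed
  have "(\<Sum>x\<in>Y. (\<Sum>s\<in>S. \<phi> (act s x))\<^sup>2)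
      = (\<Sum>y\<in>\<theta> ` Y. \<Sum>x | x \<in> Y \<and> \<theta> x = y. (\<Sum>s\<in>S. \<phi> (act s x))\<^sup>2)"
    using Y(1) by (rule sum.image_gen)
  also have "\<dots> \<le> (\<Sum>y\<in>\<theta> ` Y. (\<Sum>s\<in>S. \<psi> (act' s y))\<^sup>2)"
    using fibre by (rule sum_mono)
  also have "\<dots> \<le> (t * real (card S))\<^sup>2 * (\<Sum>z\<in>(\<Union>s\<in>S. act' s ` \<theta> ` Y). (\<psi> z)\<^sup>2)"
    using Y into by (intro averaging_boundD[OF bound]) (auto simp: \<psi>_def)
  also have "(\<Sum>z\<in>(\<Union>s\<in>S. act' s ` \<theta> ` Y). (\<psi> z)\<^sup>2) = (\<Sum>y\<in>\<theta> ` W. \<Sum>z | z \<in> W \<and> \<theta> z = y. (\<phi> z)\<^sup>2)"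
    by (simp add: image \<psi>_def L2_set_square)
  also have "\<dots> = (\<Sum>z\<in>W. (\<phi> z)\<^sup>2)"
    using W by (rule sum.image_gen[symmetric])
  finally show "(\<Sum>x\<in>Y. (\<Sum>s\<in>S. \<phi> (act s x))\<^sup>2)
      \<le> (t * real (card S))\<^sup>2 * (\<Sum>z\<in>(\<Union>s\<in>S. act s ` Y). (\<phi> z)\<^sup>2)"
    by (simp add: W_def)
qed

text \<open>
  Everything maps equivariantly to a point, where the bound 1 is trivial.
\<close>
lemma averaging_bound_one:
  assumes S: "finite S" and inj: "\<And>s. s \<in> S \<Longrightarrow> inj_on (act s) X"
  shows "averaging_bound S act X 1"
proof -
  have unit: "averaging_bound S (\<lambda>s u. u) {()} 1"
    unfolding averaging_bound_def
  proof (intro allI impI, elim conjE)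
    fix Y :: "unit set" and \<phi> :: "unit \<Rightarrow> real"
    assume "Y \<subseteq> {()}"
    then consider "Y = {}" | "Y = {()}" by blast
    then show "(\<Sum>x\<in>Y. (\<Sum>s\<in>S. \<phi> x)\<^sup>2)
        \<le> (1 * real (card S))\<^sup>2 * (\<Sum>z\<in>(\<Union>s\<in>S. (\<lambda>u. u) ` Y). (\<phi> z)\<^sup>2)"
      by cases (auto simp: power_mult_distrib)
  qed
  show ?thesis
    by (rule averaging_bound_pullback[OF unit S, where \<theta> = "\<lambda>_. ()"]) (auto intro: inj)
qed

lemma averaging_bound_partition:
  fixes act :: "'a \<Rightarrow> 'x \<Rightarrow> 'x"
  assumes S: "finite S"
    and inv: "\<And>s x. s \<in> S \<Longrightarrow> x \<in> X \<Longrightarrow> p (act s x) = p x"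
    and bound: "\<And>i. i \<in> p ` X \<Longrightarrow> averaging_bound S act {x \<in> X. p x = i} t"
  shows "averaging_bound S act X t"
  unfolding averaging_bound_def
proof (intro allI impI, elim conjE)
  fix Y and \<phi> :: "'x \<Rightarrow> real"
  assume Y: "finite Y" "Y \<subseteq> X" and pos: "\<forall>x. 0 \<le> \<phi> x"
  let ?W = "\<Union>s\<in>S. act s ` Y"
  have W: "finite ?W" using S Y by simp
  have img: "p ` ?W \<subseteq> p ` Y" using inv Y(2) by (auto simp: subset_iff)
  have piece: "(\<Union>s\<in>S. act s ` {x \<in> Y. p x = i}) = {z \<in> ?W. p z = i}" for i
    using inv Y(2) by (auto simp: subset_iff)
  have "(\<Sum>x\<in>Y. (\<Sum>s\<in>S. \<phi> (act s x))\<^sup>2)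
      = (\<Sum>i\<in>p ` Y. \<Sum>x | x \<in> Y \<and> p x = i. (\<Sum>s\<in>S. \<phi> (act s x))\<^sup>2)"
    using Y(1) by (rule sum.image_gen)
  also have "\<dots> \<le> (\<Sum>i\<in>p ` Y. (t * real (card S))\<^sup>2 *
      (\<Sum>z\<in>(\<Union>s\<in>S. act s ` {x \<in> Y. p x = i}). (\<phi> z)\<^sup>2))"
    using Y pos by (intro sum_mono averaging_boundD[OF bound]) auto
  also have "\<dots> = (t * real (card S))\<^sup>2 * (\<Sum>i\<in>p ` Y. \<Sum>z | z \<in> ?W \<and> p z = i. (\<phi> z)\<^sup>2)"
    unfolding piece by (simp add: sum_distrib_left)
  also have "(\<Sum>i\<in>p ` Y. \<Sum>z | z \<in> ?W \<and> p z = i. (\<phi> z)\<^sup>2) = (\<Sum>z\<in>?W. (\<phi> z)\<^sup>2)"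
    using Y(1) W img by (intro sum.group) auto
  finally show "(\<Sum>x\<in>Y. (\<Sum>s\<in>S. \<phi> (act s x))\<^sup>2) \<le> (t * real (card S))\<^sup>2 * (\<Sum>z\<in>?W. (\<phi> z)\<^sup>2)" .
qed

text \<open>
  A violation of the bound, normalised, and with one finite set serving both as the support of the
  test function and as the range of summation.
\<close>
lemma not_averaging_boundE:
  fixes act :: "'a \<Rightarrow> 'x \<Rightarrow> 'x"
  assumes S: "finite S" and closed: "\<And>s x. s \<in> S \<Longrightarrow> x \<in> X \<Longrightarrow> act s x \<in> X"
    and "\<not> averaging_bound S act X t"
  obtains Z \<phi> where "finite Z" "Z \<subseteq> X" "\<And>x. 0 \<le> \<phi> x" "\<And>x. x \<notin> Z \<Longrightarrow> \<phi> x = 0"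
    "(\<Sum>x\<in>Z. (\<phi> x)\<^sup>2) = 1" "(t * real (card S))\<^sup>2 < (\<Sum>x\<in>Z. (\<Sum>s\<in>S. \<phi> (act s x))\<^sup>2)"
proof -
  from assms(3) obtain Y and \<phi> :: "'x \<Rightarrow> real"
    where Y: "finite Y" "Y \<subseteq> X" and pos: "\<forall>x. 0 \<le> \<phi> x"
    and gt: "(t * real (card S))\<^sup>2 * (\<Sum>z\<in>(\<Union>s\<in>S. act s ` Y). (\<phi> z)\<^sup>2)
      < (\<Sum>x\<in>Y. (\<Sum>s\<in>S. \<phi> (act s x))\<^sup>2)"
    unfolding averaging_bound_def by (auto simp: not_le)
  define W where "W = (\<Union>s\<in>S. act s ` Y)"
  define N where "N = (\<Sum>z\<in>W. (\<phi> z)\<^sup>2)"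
  define \<psi> where "\<psi> x = (if x \<in> W then \<phi> x / sqrt N else 0)" for x
  have W: "finite W" "W \<subseteq> X" using S Y closed by (auto simp: W_def)
  have N: "N > 0"
  proof (rule ccontr)
    assume "\<not> N > 0"
    moreover have "N \<ge> 0" by (simp add: N_def sum_nonneg)
    ultimately have N0: "N = 0" by simp
    then have "\<forall>z\<in>W. \<phi> z = 0"
      using W(1) by (simp add: N_def sum_nonneg_eq_0_iff)
    then have "(\<Sum>x\<in>Y. (\<Sum>s\<in>S. \<phi> (act s x))\<^sup>2) = 0"
      by (auto simp: W_def intro!: sum.neutral)
    with gt N0 show False by (simp add: N_def W_def)
  qed
  have scale: "(\<Sum>s\<in>S. \<psi> (act s x)) = (\<Sum>s\<in>S. \<phi> (act s x)) / sqrt N" if "x \<in> Y" for x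
    unfolding sum_divide_distrib using that by (intro sum.cong) (auto simp: \<psi>_def W_def)
  have "(\<Sum>x\<in>Y. (\<Sum>s\<in>S. \<psi> (act s x))\<^sup>2) = (\<Sum>x\<in>Y. (\<Sum>s\<in>S. \<phi> (act s x))\<^sup>2) / N"
    unfolding sum_divide_distrib using N by (intro sum.cong) (auto simp: scale power_divide)
  also have "\<dots> > (t * real (card S))\<^sup>2"
    using gt N by (simp add: N_def W_def field_simps)
  finally have "(t * real (card S))\<^sup>2 < (\<Sum>x\<in>Y. (\<Sum>s\<in>S. \<psi> (act s x))\<^sup>2)" .
  also have "\<dots> \<le> (\<Sum>x\<in>Y \<union> W. (\<Sum>s\<in>S. \<psi> (act s x))\<^sup>2)"
    using Y W by (intro sum_mono2) auto
  finally have big: "(t * real (card S))\<^sup>2 < (\<Sum>x\<in>Y \<union> W. (\<Sum>s\<in>S. \<psi> (act s x))\<^sup>2)" .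
  have "(\<Sum>x\<in>Y \<union> W. (\<psi> x)\<^sup>2) = (\<Sum>x\<in>W. (\<psi> x)\<^sup>2)"
    using Y W by (intro sum.mono_neutral_right) (auto simp: \<psi>_def)
  also have "\<dots> = (\<Sum>x\<in>W. (\<phi> x)\<^sup>2) / N"
    unfolding sum_divide_distrib using N by (intro sum.cong) (auto simp: \<psi>_def power_divide)
  also have "\<dots> = 1" using N by (simp add: N_def)
  finally have "(\<Sum>x\<in>Y \<union> W. (\<psi> x)\<^sup>2) = 1" .
  with big Y W pos N show ?thesis
    by (intro that[of "Y \<union> W" \<psi>]) (auto simp: \<psi>_def)
qed

section \<open>Stabilizers and coset spaces\<close>

lemma (in group) conjugate_subgroup_iff:
  assumes "H \<subseteq> carrier G" "g \<in> carrier G"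
  shows "a \<in> conjugate_subgroup G g H \<longleftrightarrow> a \<in> carrier G \<and> inv g \<otimes> a \<otimes> g \<in> H"
proof
  assume "a \<in> conjugate_subgroup G g H"
  then obtain h where h: "h \<in> H" "a = g \<otimes> h \<otimes> inv g"
    by (auto simp: conjugate_subgroup_def l_coset_def r_coset_def)
  with assms have "h \<in> carrier G" by auto
  with h assms show "a \<in> carrier G \<and> inv g \<otimes> a \<otimes> g \<in> H"
    by (simp add: m_assoc) (simp add: m_assoc[symmetric])
next
  assume a: "a \<in> carrier G \<and> inv g \<otimes> a \<otimes> g \<in> H"
  then have "a = g \<otimes> (inv g \<otimes> a \<otimes> g) \<otimes> inv g"
    using assms by (simp add: m_assoc[symmetric]) (simp add: m_assoc)
  with a show "a \<in> conjugate_subgroup G g H"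
    by (force simp: conjugate_subgroup_def l_coset_def r_coset_def)
qed

lemma (in group) conjugate_subgroup_conjugate:
  assumes "H \<subseteq> carrier G" "g \<in> carrier G" "h \<in> carrier G"
  shows "conjugate_subgroup G g (conjugate_subgroup G h H) = conjugate_subgroup G (g \<otimes> h) H"
proof -
  have "conjugate_subgroup G h H \<subseteq> carrier G"
    using assms conjugate_subgroup_iff by blast
  with assms show ?thesis
    by (auto simp: conjugate_subgroup_iff m_assoc inv_mult_group)
qed

lemma (in group) conjugate_subgroup_one:
  "H \<subseteq> carrier G \<Longrightarrow> conjugate_subgroup G \<one> H = H"
  by (auto simp: conjugate_subgroup_iff subset_iff)

lemma (in group) conjugate_subgroup_Int:
  assumes "A \<subseteq> carrier G" "B \<subseteq> carrier G" "g \<in> carrier G"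
  shows "conjugate_subgroup G g (A \<inter> B) = conjugate_subgroup G g A \<inter> conjugate_subgroup G g B"
proof -
  have "A \<inter> B \<subseteq> carrier G" using assms by auto
  with assms show ?thesis by (auto simp: conjugate_subgroup_iff)
qed

text \<open>
  Unlike in \<open>group_action\<close>, nothing is required of the action outside \<open>X\<close>, so that left translation
  of cosets and its diagonal version on pairs are instances as they stand.
\<close>
locale set_action = group G for G (structure) +
  fixes X :: "'x set" and act :: "'a \<Rightarrow> 'x \<Rightarrow> 'x"
  assumes act_closed: "g \<in> carrier G \<Longrightarrow> x \<in> X \<Longrightarrow> act g x \<in> X"
    and act_one: "x \<in> X \<Longrightarrow> act \<one> x = x"
    and act_mult: "g \<in> carrier G \<Longrightarrow> h \<in> carrier G \<Longrightarrow> x \<in> X \<Longrightarrow> act (g \<otimes> h) x = act g (act h x)"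
begin

definition stab :: "'x \<Rightarrow> 'a set" where
  "stab x = {g \<in> carrier G. act g x = x}"

lemma act_inv_act: "g \<in> carrier G \<Longrightarrow> x \<in> X \<Longrightarrow> act (inv g) (act g x) = x"
  using act_mult[of "inv g" g x] act_one by simp

lemma act_eq_iff: "g \<in> carrier G \<Longrightarrow> x \<in> X \<Longrightarrow> y \<in> X \<Longrightarrow> act g x = y \<longleftrightarrow> x = act (inv g) y"
  by (metis act_inv_act inv_closed inv_inv)

lemma inj_on_act: "g \<in> carrier G \<Longrightarrow> inj_on (act g) X"
  by (metis act_inv_act inj_onI)

lemma subgroup_stab:
  assumes "x \<in> X"
  shows "subgroup (stab x) G"
proof (rule subgroupI)
  show "stab x \<noteq> {}" using assms act_one by (auto simp: stab_def)
  show "inv a \<in> stab x" if "a \<in> stab x" for a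
    using that assms act_inv_act[of a x] by (auto simp: stab_def)
qed (use assms in \<open>auto simp: stab_def act_mult\<close>)

lemma stab_act:
  assumes "g \<in> carrier G" "x \<in> X"
  shows "stab (act g x) = conjugate_subgroup G g (stab x)"
proof -
  have "act a (act g x) = act g x \<longleftrightarrow> act (inv g \<otimes> a \<otimes> g) x = x" if "a \<in> carrier G" for a
    using that assms by (simp add: act_mult act_closed act_eq_iff[of "inv g"])
  moreover have "stab x \<subseteq> carrier G" by (auto simp: stab_def)
  ultimately show ?thesis
    using assms by (auto simp: conjugate_subgroup_iff) (auto simp: stab_def)
qed

lemma transporter_eq_l_coset:
  assumes "g \<in> carrier G" "x \<in> X"
  shows "{a \<in> carrier G. act a x = act g x} = g <# stab x"
proof (intro equalityI subsetI)
  fix a assume a: "a \<in> {a \<in> carrier G. act a x = act g x}"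
  with assms have "inv g \<otimes> a \<in> stab x"
    by (auto simp: stab_def act_mult act_inv_act)
  moreover have "a = g \<otimes> (inv g \<otimes> a)"
    using a assms by (simp add: m_assoc[symmetric])
  ultimately show "a \<in> g <# stab x" by (auto simp: l_coset_def)
next
  fix a assume "a \<in> g <# stab x"
  then show "a \<in> {a \<in> carrier G. act a x = act g x}"
    using assms by (auto simp: l_coset_def stab_def act_mult)
qed

text \<open>
  The orbit of \<open>x\<close> is the coset space of the stabilizer, a point \<open>y\<close> corresponding to the coset of all
  elements that carry \<open>x\<close> to \<open>y\<close>.
\<close>
lemma averaging_bound_orbit:
  assumes S: "finite S" "S \<subseteq> carrier G" and x: "x \<in> X"
    and bound: "averaging_bound S (l_coset G) (lcosets (stab x)) t"
  shows "averaging_bound S act ((\<lambda>g. act g x) ` carrier G) t"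
proof (rule averaging_bound_pullback[OF bound S(1), where \<theta> = "\<lambda>y. {a \<in> carrier G. act a x = y}"])
  let ?\<theta> = "\<lambda>y. {a \<in> carrier G. act a x = y}"
  show "?\<theta> ` (\<lambda>g. act g x) ` carrier G \<subseteq> lcosets (stab x)"
    using x by (auto simp: transporter_eq_l_coset LCOSETS_def)
  show "inj_on (act s) ((\<lambda>g. act g x) ` carrier G)" if "s \<in> S" for s
    using that S(2) x inj_on_act act_closed by (blast intro: inj_on_subset)
  fix s y assume s: "s \<in> S" and "y \<in> (\<lambda>g. act g x) ` carrier G"
  then obtain g where g: "g \<in> carrier G" "y = act g x" by auto
  have sc: "s \<in> carrier G" using s S by auto
  have "act s y = act (s \<otimes> g) x" using g sc x by (simp add: act_mult)
  moreover have "stab x \<subseteq> carrier G" by (auto simp: stab_def)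
  ultimately show "?\<theta> (act s y) = s <# ?\<theta> y"
    using g sc x by (simp add: transporter_eq_l_coset lcos_m_assoc)
qed

lemma averaging_bound_stabilizers:
  assumes S: "finite S" "S \<subseteq> carrier G"
    and bound: "\<And>x. x \<in> X \<Longrightarrow> averaging_bound S (l_coset G) (lcosets (stab x)) t"
  shows "averaging_bound S act X t"
proof (rule averaging_bound_partition[OF S(1), where p = "\<lambda>x. (\<lambda>g. act g x) ` carrier G"])
  let ?orb = "\<lambda>x. (\<lambda>g. act g x) ` carrier G"
  have orb_act: "?orb (act h x) = ?orb x" if hx: "h \<in> carrier G" "x \<in> X" for h x
  proof (intro equalityI subsetI)
    fix y assume "y \<in> ?orb (act h x)"
    then show "y \<in> ?orb x" using hx by (auto simp: act_mult[symmetric])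
  next
    fix y assume "y \<in> ?orb x"
    then obtain g where g: "g \<in> carrier G" "y = act g x" by auto
    then have "y = act (g \<otimes> inv h) (act h x)"
      using hx by (simp add: act_mult act_inv_act act_closed)
    then show "y \<in> ?orb (act h x)" using g hx by blast
  qed
  show "?orb (act s x) = ?orb x" if "s \<in> S" "x \<in> X" for s x
    using that S by (intro orb_act) auto
  fix i assume "i \<in> ?orb ` X"
  then obtain x where x: "x \<in> X" "i = ?orb x" by auto
  have "{y \<in> X. ?orb y = i} = ?orb x"
  proof (intro equalityI subsetI)
    fix y assume y: "y \<in> {y \<in> X. ?orb y = i}"
    then have "act \<one> y \<in> ?orb y" by blast
    with y x show "y \<in> ?orb x" by (simp add: act_one)
  next
    fix y assume "y \<in> ?orb x"
    then obtain g where g: "g \<in> carrier G" "y = act g x" by auto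
    then have "?orb y = i" unfolding x(2) g(2) using x(1) by (intro orb_act)
    with g x(1) act_closed show "y \<in> {y \<in> X. ?orb y = i}" by blast
  qed
  with averaging_bound_orbit[OF S x(1) bound[OF x(1)]]
  show "averaging_bound S act {y \<in> X. ?orb y = i} t" by simp
qed

end

context group
begin

lemma set_action_lcosets:
  assumes "subgroup H G"
  shows "set_action G (lcosets H) (l_coset G)"
proof unfold_locales
  have H: "H \<subseteq> carrier G" using assms by (rule subgroup.subset)
  show "g <# C \<in> lcosets H" if "g \<in> carrier G" "C \<in> lcosets H" for g C
    using that H by (auto simp: LCOSETS_def lcos_m_assoc)
  show "\<one> <# C = C" if "C \<in> lcosets H" for C
    using that H by (auto simp: LCOSETS_def lcos_m_assoc)
  show "(g \<otimes> h) <# C = g <# (h <# C)" if "g \<in> carrier G" "h \<in> carrier G" "C \<in> lcosets H" for g h C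
    using that H by (auto simp: LCOSETS_def lcos_m_assoc m_assoc)
qed

abbreviation coset_stab :: "'a set \<Rightarrow> 'a set" where
  "coset_stab C \<equiv> {g \<in> carrier G. g <# C = C}"

lemma self_in_lcosets: "subgroup H G \<Longrightarrow> H \<in> lcosets H"
  using lcos_mult_one[of H] subgroup.subset[of H G] by (force simp: LCOSETS_def)

lemma coset_stab_subgroup:
  assumes H: "subgroup H G"
  shows "coset_stab H = H"
proof (intro equalityI subsetI)
  fix g assume "g \<in> coset_stab H"
  then show "g \<in> H" using lcos_self[OF _ H, of g] by auto
next
  fix g assume "g \<in> H"
  then show "g \<in> coset_stab H"
    using H coset_join3[of g H] subgroup.subset[OF H] by auto
qed

lemma coset_stab_translate:
  assumes H: "subgroup H G" and g: "g \<in> carrier G" and C: "C \<in> lcosets H"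
  shows "coset_stab (g <# C) = conjugate_subgroup G g (coset_stab C)"
proof -
  interpret set_action G "lcosets H" "l_coset G" using H by (rule set_action_lcosets)
  show ?thesis using stab_act[OF g C] by (simp add: stab_def)
qed

lemma subgroup_coset_stab:
  assumes H: "subgroup H G" and C: "C \<in> lcosets H"
  shows "subgroup (coset_stab C) G"
proof -
  interpret set_action G "lcosets H" "l_coset G" using H by (rule set_action_lcosets)
  show ?thesis using subgroup_stab[OF C] by (simp add: stab_def)
qed

lemma coset_stab_l_coset:
  assumes H: "subgroup H G" and g: "g \<in> carrier G"
  shows "coset_stab (g <# H) = conjugate_subgroup G g H"
  using coset_stab_translate[OF H g self_in_lcosets[OF H]] coset_stab_subgroup[OF H] by simp

lemma subgroup_conjugate_subgroup:
  assumes H: "subgroup H G" and g: "g \<in> carrier G"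
  shows "subgroup (conjugate_subgroup G g H) G"
proof -
  have "g <# H \<in> lcosets H" using g by (auto simp: LCOSETS_def)
  from subgroup_coset_stab[OF H this] show ?thesis
    unfolding coset_stab_l_coset[OF H g] .
qed

lemma inj_on_l_coset: "subgroup H G \<Longrightarrow> g \<in> carrier G \<Longrightarrow> inj_on (l_coset G g) (lcosets H)"
  by (rule set_action.inj_on_act[OF set_action_lcosets])

text \<open>
  In \<open>lcosets H\<close> the point \<open>g <# H\<close> has stabilizer \<open>conjugate_subgroup G g H\<close>, and its orbit is everything.
\<close>
lemma averaging_bound_conjugate:
  assumes S: "finite S" "S \<subseteq> carrier G" and H: "subgroup H G" and g: "g \<in> carrier G"
  shows "averaging_bound S (l_coset G) (lcosets (conjugate_subgroup G g H)) t
     \<longleftrightarrow> averaging_bound S (l_coset G) (lcosets H) t"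
proof -
  have imp: "averaging_bound S (l_coset G) (lcosets H) t"
    if bound: "averaging_bound S (l_coset G) (lcosets (conjugate_subgroup G g H)) t"
      and H: "subgroup H G" and g: "g \<in> carrier G" for H g
  proof -
    interpret set_action G "lcosets H" "l_coset G" using H by (rule set_action_lcosets)
    have "(\<lambda>a. a <# (g <# H)) ` carrier G = lcosets H"
    proof (intro equalityI subsetI)
      fix C assume "C \<in> lcosets H"
      then obtain a where a: "a \<in> carrier G" "C = a <# H" by (auto simp: LCOSETS_def)
      then have "C = (a \<otimes> inv g) <# (g <# H)"
        using g subgroup.subset[OF H] by (simp add: lcos_m_assoc m_assoc)
      then show "C \<in> (\<lambda>a. a <# (g <# H)) ` carrier G" using a g by blast
    qed (use g act_closed self_in_lcosets[OF H] in auto)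
    with averaging_bound_orbit[OF S act_closed[OF g self_in_lcosets[OF H]], of t]
    show ?thesis
      using bound coset_stab_l_coset[OF H g] by (simp add: stab_def)
  qed
  have "conjugate_subgroup G (inv g) (conjugate_subgroup G g H) = H"
    using g subgroup.subset[OF H] by (simp add: conjugate_subgroup_conjugate conjugate_subgroup_one)
  then show ?thesis
    using imp[of g H] imp[of "inv g" "conjugate_subgroup G g H"] H g subgroup_conjugate_subgroup
    by auto
qed

lemma averaging_bound_mono:
  assumes S: "finite S" "S \<subseteq> carrier G" and K: "subgroup K G" and H: "subgroup H G" and KH: "K \<subseteq> H"
    and bound: "averaging_bound S (l_coset G) (lcosets H) t"
  shows "averaging_bound S (l_coset G) (lcosets K) t"
proof (rule averaging_bound_pullback[OF bound S(1), where \<theta> = "\<lambda>C. C <#> H"])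
  have KHH: "K <#> H = H"
  proof (intro equalityI subsetI)
    fix h assume "h \<in> H"
    then have "h = \<one> \<otimes> h" using H by (simp add: subgroup.mem_carrier)
    then show "h \<in> K <#> H"
      using \<open>h \<in> H\<close> subgroup.one_closed[OF K] unfolding set_mult_def by blast
  qed (use KH H in \<open>auto simp: set_mult_def subgroup.m_closed\<close>)
  note sub = subgroup.subset[OF K] subgroup.subset[OF H]
  show "(\<lambda>C. C <#> H) ` (lcosets K) \<subseteq> lcosets H"
    using sub by (auto simp: LCOSETS_def setmult_lcos_assoc KHH)
  show "inj_on (l_coset G s) (lcosets K)" if "s \<in> S" for s
    using that S K inj_on_l_coset by auto
  show "(s <# C) <#> H = s <# (C <#> H)" if "s \<in> S" "C \<in> lcosets K" for s C
    using that sub S subgroup.lcosets_carrier[OF K group_axioms] by (intro setmult_lcos_assoc) auto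
qed

text \<open>
  A violation of the bound involves finitely many cosets \<open>C\<close> and their translates. With chosen
  representatives, finitely many relations \<open>s \<otimes> r C \<in> r (s <# C) <# H\<close> make \<open>C \<mapsto> r C <# K\<close> an equivariant
  map on these cosets. They persist for every \<open>K\<close> that contains the finitely many elements
  \<open>inv (r (s <# C)) \<otimes> (s \<otimes> r C)\<close> of \<open>H\<close>, so a bound for such a \<open>K\<close> would pull back.
\<close>
lemma averaging_bound_open:
  assumes S: "finite S" "S \<subseteq> carrier G" and H: "subgroup H G"
    and nb: "\<not> averaging_bound S (l_coset G) (lcosets H) t"
  obtains F where "finite F" "F \<subseteq> H"
    "\<And>K. subgroup K G \<Longrightarrow> F \<subseteq> K \<Longrightarrow> \<not> averaging_bound S (l_coset G) (lcosets K) t"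
proof -
  interpret set_action G "lcosets H" "l_coset G" using H by (rule set_action_lcosets)
  obtain Y where Y: "finite Y" "Y \<subseteq> lcosets H" and nbY: "\<not> averaging_bound S (l_coset G) Y t"
    using nb unfolding averaging_bound_def by blast
  define r where "r C = (SOME a. a \<in> carrier G \<and> C = a <# H)" for C
  have r: "r C \<in> carrier G" "r C <# H = C" if "C \<in> lcosets H" for C
  proof -
    have "\<exists>a. a \<in> carrier G \<and> C = a <# H" using that by (auto simp: LCOSETS_def)
    from someI_ex[OF this] show "r C \<in> carrier G" "r C <# H = C" by (auto simp: r_def)
  qed
  define F where "F = (\<lambda>(s, C). inv (r (s <# C)) \<otimes> (s \<otimes> r C)) ` (S \<times> Y)"
  show thesis
  proof (rule that)
    show "finite F" using S Y by (simp add: F_def)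
    show "F \<subseteq> H"
    proof
      fix f assume "f \<in> F"
      then obtain s C where sC: "s \<in> S" "C \<in> Y" "f = inv (r (s <# C)) \<otimes> (s \<otimes> r C)"
        by (auto simp: F_def)
      have s: "s \<in> carrier G" and C: "C \<in> lcosets H" and C': "s <# C \<in> lcosets H"
        using sC S Y act_closed by auto
      have "(s \<otimes> r C) <# H = r (s <# C) <# H"
        using r[OF C] r[OF C'] s subgroup.subset[OF H] by (simp add: lcos_m_assoc[symmetric])
      then have "s \<otimes> r C \<in> r (s <# C) <# H"
        using lcos_self[OF _ H, of "s \<otimes> r C"] s r(1)[OF C] by auto
      then show "f \<in> H"
        using subgroup.lcos_module_imp[OF H group_axioms] r(1)[OF C'] sC(3) by blast
    qed
    fix K assume K: "subgroup K G" and FK: "F \<subseteq> K"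
    show "\<not> averaging_bound S (l_coset G) (lcosets K) t"
    proof
      assume bound: "averaging_bound S (l_coset G) (lcosets K) t"
      have "averaging_bound S (l_coset G) Y t"
      proof (rule averaging_bound_pullback[OF bound S(1), where \<theta> = "\<lambda>C. r C <# K"])
        have "r C <# K \<in> lcosets K" if "C \<in> Y" for C
          using r(1)[of C] Y(2) that unfolding LCOSETS_def[of G K] by blast
        then show "(\<lambda>C. r C <# K) ` Y \<subseteq> lcosets K" by blast
        show "inj_on (l_coset G s) Y" if "s \<in> S" for s
          using that S(2) by (intro inj_on_subset[OF inj_on_act Y(2)]) auto
        fix s C assume sC: "s \<in> S" "C \<in> Y"
        have s: "s \<in> carrier G" and C: "C \<in> lcosets H" and C': "s <# C \<in> lcosets H"
          using sC S Y act_closed by auto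
        have "inv (r (s <# C)) \<otimes> (s \<otimes> r C) \<in> K" using FK sC by (auto simp: F_def)
        then have "s \<otimes> r C \<in> r (s <# C) <# K"
          using subgroup.lcos_module_rev[OF K group_axioms] r(1)[OF C'] r(1)[OF C] s by auto
        then have "r (s <# C) <# K = (s \<otimes> r C) <# K"
          using l_repr_independence K r(1)[OF C'] by blast
        then show "r (s <# C) <# K = s <# (r C <# K)"
          using r(1)[OF C] s subgroup.subset[OF K] by (simp add: lcos_m_assoc)
      qed
      with nbY show False ..
    qed
  qed
qed

end

section \<open>The co-spectral radius as an averaging bound\<close>

lemma (in group) averaging_operator_ell2:
  assumes S: "finite S" "S \<noteq> {}" "S \<subseteq> carrier G" and H: "subgroup H G"
    and bound: "averaging_bound S (l_coset G) (lcosets H) t" and t: "0 \<le> t"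
    and \<phi>: "\<phi> \<in> ell2 (lcosets H)"
  shows "averaging_operator G S \<phi> \<in> ell2 (lcosets H)"
    and "ell2_norm (lcosets H) (averaging_operator G S \<phi>) \<le> t * ell2_norm (lcosets H) \<phi>"
proof -
  interpret set_action G "lcosets H" "l_coset G" using H by (rule set_action_lcosets)
  let ?n = "real (card S)"
  let ?f = "\<lambda>C. (cmod (averaging_operator G S \<phi> C))\<^sup>2"
  let ?N = "\<Sum>\<^sub>\<infinity>C\<in>lcosets H. (cmod (\<phi> C))\<^sup>2"
  have n: "?n > 0" using S by (simp add: card_gt_0_iff)
  have fin: "sum ?f F \<le> t\<^sup>2 * ?N" if F: "finite F" "F \<subseteq> lcosets H" for F
  proof -
    have "?f C \<le> (1 / ?n)\<^sup>2 * (\<Sum>s\<in>S. cmod (\<phi> (s <# C)))\<^sup>2" for C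
      unfolding averaging_operator_def norm_mult power_mult_distrib
      by (intro mult_mono power_mono norm_sum) (auto simp: norm_divide)
    then have "sum ?f F \<le> (\<Sum>C\<in>F. (1 / ?n)\<^sup>2 * (\<Sum>s\<in>S. cmod (\<phi> (s <# C)))\<^sup>2)"
      by (rule sum_mono)
    also have "\<dots> = (1 / ?n)\<^sup>2 * (\<Sum>C\<in>F. (\<Sum>s\<in>S. cmod (\<phi> (s <# C)))\<^sup>2)"
      by (simp add: sum_distrib_left)
    also have "\<dots> \<le> (1 / ?n)\<^sup>2 * ((t * ?n)\<^sup>2 * (\<Sum>C\<in>(\<Union>s\<in>S. l_coset G s ` F). (cmod (\<phi> C))\<^sup>2))"
      using F by (intro mult_left_mono averaging_boundD[OF bound]) auto
    also have "\<dots> = t\<^sup>2 * (\<Sum>C\<in>(\<Union>s\<in>S. l_coset G s ` F). (cmod (\<phi> C))\<^sup>2)"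
      using n by (simp add: power_mult_distrib power_divide)
    also have "\<dots> \<le> t\<^sup>2 * ?N"
      using \<phi> F S act_closed by (intro mult_left_mono finite_sum_le_infsum) (auto simp: ell2_def)
    finally show ?thesis .
  qed
  have summable: "?f summable_on lcosets H"
    by (rule nonneg_bdd_above_summable_on) (use fin in \<open>auto intro!: bdd_aboveI2\<close>)
  then show "averaging_operator G S \<phi> \<in> ell2 (lcosets H)" by (simp add: ell2_def)
  have "infsum ?f (lcosets H) \<le> t\<^sup>2 * ?N"
    using summable fin by (intro infsum_le_finite_sums) auto
  then have "ell2_norm (lcosets H) (averaging_operator G S \<phi>) \<le> sqrt (t\<^sup>2 * ?N)"
    by (simp add: ell2_norm_def)
  also have "\<dots> = t * ell2_norm (lcosets H) \<phi>"
    using t by (simp add: ell2_norm_def real_sqrt_mult)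
  finally show "ell2_norm (lcosets H) (averaging_operator G S \<phi>) \<le> t * ell2_norm (lcosets H) \<phi>" .
qed

lemma (in group) bdd_above_averaging_operator:
  assumes S: "finite S" "S \<noteq> {}" "S \<subseteq> carrier G" and H: "subgroup H G"
  shows "bdd_above ((\<lambda>\<phi>. ell2_norm (lcosets H) (averaging_operator G S \<phi>)) `
      {\<phi> \<in> ell2 (lcosets H). ell2_norm (lcosets H) \<phi> \<le> 1})"
proof (rule bdd_aboveI2)
  have "averaging_bound S (l_coset G) (lcosets H) 1"
    using S H by (intro averaging_bound_one inj_on_l_coset) auto
  then show "ell2_norm (lcosets H) (averaging_operator G S \<phi>) \<le> 1"
    if "\<phi> \<in> {\<phi> \<in> ell2 (lcosets H). ell2_norm (lcosets H) \<phi> \<le> 1}" for \<phi>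
    using that averaging_operator_ell2(2)[OF S H, of 1 \<phi>] by simp
qed

text \<open>
  From here on the co-spectral radius is handled through \<^const>\<open>averaging_bound\<close>.
\<close>
lemma (in group) cospectral_radius_le_iff:
  assumes S: "finite S" "S \<noteq> {}" "S \<subseteq> carrier G" and H: "subgroup H G" and t: "0 \<le> t"
  shows "cospectral_radius G S H \<le> t \<longleftrightarrow> averaging_bound S (l_coset G) (lcosets H) t"
proof
  assume bound: "averaging_bound S (l_coset G) (lcosets H) t"
  have zero: "(\<lambda>_. 0) \<in> {\<phi> \<in> ell2 (lcosets H). ell2_norm (lcosets H) \<phi> \<le> 1}"
    by (simp add: ell2_def ell2_norm_def)
  show "cospectral_radius G S H \<le> t"
    unfolding cospectral_radius_def
  proof (rule cSUP_least)
    fix \<phi> assume \<phi>: "\<phi> \<in> {\<phi> \<in> ell2 (lcosets H). ell2_norm (lcosets H) \<phi> \<le> 1}"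
    then have "ell2_norm (lcosets H) (averaging_operator G S \<phi>) \<le> t * ell2_norm (lcosets H) \<phi>"
      using averaging_operator_ell2(2)[OF S H bound t] by simp
    also have "\<dots> \<le> t" using \<phi> t by (simp add: mult_left_le)
    finally show "ell2_norm (lcosets H) (averaging_operator G S \<phi>) \<le> t" .
  qed (use zero in blast)
next
  assume le: "cospectral_radius G S H \<le> t"
  interpret set_action G "lcosets H" "l_coset G" using H by (rule set_action_lcosets)
  let ?n = "real (card S)"
  have n: "?n > 0" using S by (simp add: card_gt_0_iff)
  show "averaging_bound S (l_coset G) (lcosets H) t"
  proof (rule ccontr)
    assume "\<not> averaging_bound S (l_coset G) (lcosets H) t"
    then obtain Z \<phi> where Z: "finite Z" "Z \<subseteq> lcosets H" and pos: "\<And>C. 0 \<le> \<phi> C"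
      and supp: "\<And>C. C \<notin> Z \<Longrightarrow> \<phi> C = 0" and norm1: "(\<Sum>C\<in>Z. (\<phi> C)\<^sup>2) = 1"
      and gt: "(t * ?n)\<^sup>2 < (\<Sum>C\<in>Z. (\<Sum>s\<in>S. \<phi> (s <# C))\<^sup>2)"
      using not_averaging_boundE[OF S(1), of "lcosets H" "l_coset G" t] act_closed S(3) by blast
    let ?\<phi> = "\<lambda>C. complex_of_real (\<phi> C)"
    have "(\<lambda>C. (cmod (?\<phi> C))\<^sup>2) summable_on lcosets H \<longleftrightarrow> (\<lambda>C. (\<phi> C)\<^sup>2) summable_on Z"
      using Z supp by (intro summable_on_cong_neutral) auto
    then have ell2: "?\<phi> \<in> ell2 (lcosets H)"
      using Z by (simp add: ell2_def)
    have "(\<Sum>\<^sub>\<infinity>C\<in>lcosets H. (cmod (?\<phi> C))\<^sup>2) = (\<Sum>\<^sub>\<infinity>C\<in>Z. (\<phi> C)\<^sup>2)"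
      using Z supp by (intro infsum_cong_neutral) auto
    then have unit: "ell2_norm (lcosets H) ?\<phi> = 1"
      using Z norm1 by (simp add: ell2_norm_def)
    have M: "(cmod (averaging_operator G S ?\<phi> C))\<^sup>2 = (\<Sum>s\<in>S. \<phi> (s <# C))\<^sup>2 / ?n\<^sup>2" for C
    proof -
      have "cmod (\<Sum>s\<in>S. ?\<phi> (s <# C)) = \<bar>\<Sum>s\<in>S. \<phi> (s <# C)\<bar>"
        unfolding of_real_sum[symmetric] by (rule norm_of_real)
      then show ?thesis
        by (simp add: averaging_operator_def norm_mult norm_divide power_mult_distrib power_divide)
    qed
    have "averaging_bound S (l_coset G) (lcosets H) 1"
      using S H by (intro averaging_bound_one inj_on_l_coset) auto
    then have Mell2: "averaging_operator G S ?\<phi> \<in> ell2 (lcosets H)"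
      using averaging_operator_ell2(1)[OF S H _ _ ell2] by simp
    have "t\<^sup>2 < (\<Sum>C\<in>Z. (\<Sum>s\<in>S. \<phi> (s <# C))\<^sup>2) / ?n\<^sup>2"
      using gt n by (simp add: power_mult_distrib field_simps)
    also have "\<dots> = (\<Sum>C\<in>Z. (cmod (averaging_operator G S ?\<phi> C))\<^sup>2)"
      by (simp add: M sum_divide_distrib)
    also have "\<dots> \<le> (\<Sum>\<^sub>\<infinity>C\<in>lcosets H. (cmod (averaging_operator G S ?\<phi> C))\<^sup>2)"
      using Mell2 Z by (intro finite_sum_le_infsum) (auto simp: ell2_def)
    finally have "t < ell2_norm (lcosets H) (averaging_operator G S ?\<phi>)"
      using t real_less_rsqrt by (simp add: ell2_norm_def)
    also have "\<dots> \<le> cospectral_radius G S H"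
      unfolding cospectral_radius_def using ell2 unit
      by (intro cSUP_upper bdd_above_averaging_operator S H) auto
    finally show False using le by simp
  qed
qed

lemma (in group) cospectral_radius_nonneg:
  assumes S: "finite S" "S \<noteq> {}" "S \<subseteq> carrier G" and H: "subgroup H G"
  shows "0 \<le> cospectral_radius G S H"
proof -
  have "0 \<le> ell2_norm (lcosets H) (averaging_operator G S (\<lambda>_. 0))"
    by (simp add: ell2_norm_def infsum_nonneg)
  also have "\<dots> \<le> cospectral_radius G S H"
    unfolding cospectral_radius_def
    by (rule cSUP_upper[OF _ bdd_above_averaging_operator[OF assms]])
      (simp add: ell2_def ell2_norm_def)
  finally show ?thesis .
qed

lemma (in group) cospectral_radius_le_one:
  assumes S: "finite S" "S \<noteq> {}" "S \<subseteq> carrier G" and H: "subgroup H G"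
  shows "cospectral_radius G S H \<le> 1"
  using assms by (subst cospectral_radius_le_iff) (auto intro!: averaging_bound_one inj_on_l_coset)

lemma (in group) cospectral_radius_conjugate:
  assumes S: "finite S" "S \<noteq> {}" "S \<subseteq> carrier G" and H: "subgroup H G" and g: "g \<in> carrier G"
  shows "cospectral_radius G S (conjugate_subgroup G g H) = cospectral_radius G S H"
proof -
  have H': "subgroup (conjugate_subgroup G g H) G" using H g by (rule subgroup_conjugate_subgroup)
  have "cospectral_radius G S (conjugate_subgroup G g H) \<le> t \<longleftrightarrow> cospectral_radius G S H \<le> t"
    if "0 \<le> t" for t
    using cospectral_radius_le_iff[OF S H that] cospectral_radius_le_iff[OF S H' that]
      averaging_bound_conjugate[OF S(1,3) H g] by simp
  then show ?thesis
    using cospectral_radius_nonneg[OF S H] cospectral_radius_nonneg[OF S H'] by (meson order_antisym order_refl)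
qed

lemma (in group) cospectral_radius_mono:
  assumes S: "finite S" "S \<noteq> {}" "S \<subseteq> carrier G" and K: "subgroup K G" and H: "subgroup H G"
    and "K \<subseteq> H"
  shows "cospectral_radius G S K \<le> cospectral_radius G S H"
  using cospectral_radius_le_iff[OF S K cospectral_radius_nonneg[OF S H]]
    cospectral_radius_le_iff[OF S H cospectral_radius_nonneg[OF S H]]
    averaging_bound_mono[OF S(1,3) K H \<open>K \<subseteq> H\<close>] by simp

section \<open>Almost invariant measures on the cosets of a co-amenable subgroup\<close>

text \<open>
  Reiter's condition. It suffices to compare \<open>\<nu>\<close> with its translate on the support \<open>Z\<close>: the
  two have the same total mass, so what the translate loses on \<open>Z\<close> is what it has outside.
\<close>
definition (in group) almost_invariant_measure ::
    "'a set \<Rightarrow> 'a set \<Rightarrow> real \<Rightarrow> 'a set set \<Rightarrow> ('a set \<Rightarrow> real) \<Rightarrow> bool" where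
  "almost_invariant_measure H F \<delta> Z \<nu> \<longleftrightarrow>
     finite Z \<and> Z \<subseteq> lcosets H \<and> (\<forall>C. 0 \<le> \<nu> C) \<and> (\<forall>C. C \<notin> Z \<longrightarrow> \<nu> C = 0) \<and> (\<Sum>C\<in>Z. \<nu> C) = 1 \<and>
     (\<forall>g\<in>F. (\<Sum>C\<in>Z. \<bar>\<nu> (g <# C) - \<nu> C\<bar>) \<le> \<delta>)"

text \<open>
  The right-hand side is the sum of \<open>(a k - a l)\<^sup>2\<close> over all pairs of indices.
\<close>
lemma sum_square_defect:
  fixes a :: "'i \<Rightarrow> real"
  assumes I: "finite I" "i \<in> I" "j \<in> I"
  shows "(a i - a j)\<^sup>2 \<le> 2 * (real (card I) * (\<Sum>k\<in>I. (a k)\<^sup>2) - (\<Sum>k\<in>I. a k)\<^sup>2)"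
proof -
  have "(a i - a j)\<^sup>2 \<le> (\<Sum>l\<in>I. (a i - a l)\<^sup>2)"
    using I by (intro member_le_sum) auto
  also have "\<dots> \<le> (\<Sum>k\<in>I. \<Sum>l\<in>I. (a k - a l)\<^sup>2)"
    using I by (intro member_le_sum[where f = "\<lambda>k. \<Sum>l\<in>I. (a k - a l)\<^sup>2"]) (auto intro: sum_nonneg)
  also have "\<dots> = 2 * (real (card I) * (\<Sum>k\<in>I. (a k)\<^sup>2) - (\<Sum>k\<in>I. a k)\<^sup>2)"
    by (simp add: power2_diff sum.distrib sum_subtractf sum_distrib_left[symmetric]
        sum_distrib_right[symmetric] power2_eq_square[of "sum a I"] algebra_simps)
  finally show ?thesis .
qed

text \<open>
  Adjoin \<open>\<one>\<close> and inverses to \<open>F\<close>. Since the norm of the resulting averaging operator is 1, some unit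
  vector \<open>\<phi>\<close> is hardly shortened. Its translates all have norm at most 1, so by strict convexity
  they nearly coincide, and one of them is \<open>\<phi>\<close> itself. Then \<open>\<phi>\<^sup>2\<close> is nearly invariant in \<open>\<ell>\<^sup>1\<close>.
\<close>
lemma (in group) coamenable_almost_invariant:
  assumes H: "subgroup H G" and co: "coamenable G H"
    and F: "finite F" "F \<subseteq> carrier G" and \<delta>: "0 < \<delta>"
  obtains Z \<nu> where "almost_invariant_measure H F \<delta> Z \<nu>"
proof -
  interpret set_action G "lcosets H" "l_coset G" using H by (rule set_action_lcosets)
  define S where "S = insert \<one> (F \<union> m_inv G ` F)"
  let ?n = "real (card S)"
  have S: "finite S" "S \<noteq> {}" "S \<subseteq> carrier G" "\<one> \<in> S" "F \<subseteq> S"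
    using F by (auto simp: S_def)
  have "finite_symmetric_subset G S"
    using F by (auto simp: finite_symmetric_subset_def S_def subset_iff)
  with co have one: "cospectral_radius G S H = 1" by (simp add: coamenable_def)
  have n: "?n > 0" using S by (simp add: card_gt_0_iff)
  \<comment> \<open>The deficit \<open>1 - t\<^sup>2\<close>, chosen so that \<open>2 * card S\<^sup>2 * e \<le> (\<delta> / 2)\<^sup>2\<close>; the minimum keeps \<open>t\<close> real.\<close>
  define e where "e = min 1 (\<delta>\<^sup>2 / (8 * ?n\<^sup>2))"
  have e: "0 < e" "e \<le> 1" using \<delta> n by (auto simp: e_def)
  have e\<delta>: "8 * ?n\<^sup>2 * e \<le> \<delta>\<^sup>2"
  proof -
    have "e \<le> \<delta>\<^sup>2 / (8 * ?n\<^sup>2)" by (simp add: e_def)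
    then show ?thesis using n by (simp add: field_simps)
  qed
  define t where "t = sqrt (1 - e)"
  have t: "0 \<le> t" "t < 1" "t\<^sup>2 = 1 - e" using e by (auto simp: t_def)
  have "\<not> averaging_bound S (l_coset G) (lcosets H) t"
    using one t cospectral_radius_le_iff[OF S(1-3) H t(1)] by simp
  then obtain Z \<phi> where Z: "finite Z" "Z \<subseteq> lcosets H" and pos: "\<And>C. 0 \<le> \<phi> C"
    and supp: "\<And>C. C \<notin> Z \<Longrightarrow> \<phi> C = 0" and norm1: "(\<Sum>C\<in>Z. (\<phi> C)\<^sup>2) = 1"
    and gt: "(t * ?n)\<^sup>2 < (\<Sum>C\<in>Z. (\<Sum>s\<in>S. \<phi> (s <# C))\<^sup>2)"
    using not_averaging_boundE[OF S(1), of "lcosets H" "l_coset G" t] act_closed S(3) by blast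
  have shift: "(\<Sum>C\<in>Z. (\<phi> (s <# C))\<^sup>2) \<le> 1" if s: "s \<in> S" for s
  proof -
    have "inj_on (l_coset G s) Z"
      using s S(3) by (intro inj_on_subset[OF inj_on_act Z(2)]) auto
    then have "(\<Sum>C\<in>Z. (\<phi> (s <# C))\<^sup>2) = (\<Sum>C\<in>l_coset G s ` Z. (\<phi> C)\<^sup>2)"
      by (simp add: sum.reindex)
    also have "\<dots> = (\<Sum>C\<in>l_coset G s ` Z \<inter> Z. (\<phi> C)\<^sup>2)"
      using Z supp by (intro sum.mono_neutral_right) auto
    also have "\<dots> \<le> (\<Sum>C\<in>Z. (\<phi> C)\<^sup>2)"
      using Z by (intro sum_mono2) auto
    finally show ?thesis using norm1 by simp
  qed
  have L2_shift: "L2_set (\<lambda>C. \<phi> (s <# C)) Z \<le> 1" if "s \<in> S" for s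
    using shift[OF that] by (simp add: L2_set_def)
  have unit_act: "\<phi> (\<one> <# C) = \<phi> C" if "C \<in> Z" for C
    using that Z act_one by auto
  have "(\<Sum>C\<in>Z. \<bar>(\<phi> (g <# C))\<^sup>2 - (\<phi> C)\<^sup>2\<bar>) \<le> \<delta>" if "g \<in> F" for g
  proof -
    from \<open>g \<in> F\<close> have g: "g \<in> S" using S by auto
    have "(\<Sum>C\<in>Z. (\<phi> (g <# C) - \<phi> C)\<^sup>2) = (\<Sum>C\<in>Z. (\<phi> (g <# C) - \<phi> (\<one> <# C))\<^sup>2)"
      using unit_act by simp
    also have "\<dots> \<le> (\<Sum>C\<in>Z. 2 * (?n * (\<Sum>s\<in>S. (\<phi> (s <# C))\<^sup>2) - (\<Sum>s\<in>S. \<phi> (s <# C))\<^sup>2))"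
      using S g by (intro sum_mono sum_square_defect[of S g \<one> "\<lambda>s. \<phi> (s <# C)" for C])
    also have "\<dots> = 2 * (?n * (\<Sum>s\<in>S. \<Sum>C\<in>Z. (\<phi> (s <# C))\<^sup>2) - (\<Sum>C\<in>Z. (\<Sum>s\<in>S. \<phi> (s <# C))\<^sup>2))"
      by (subst sum.swap) (simp add: sum_subtractf sum_distrib_left)
    also have "\<dots> \<le> 2 * (?n * (\<Sum>s\<in>S. 1) - (t * ?n)\<^sup>2)"
      using gt shift by (intro mult_left_mono diff_mono sum_mono) auto
    also have "\<dots> = 2 * ?n\<^sup>2 * e"
      unfolding power_mult_distrib t(3) by (simp add: power2_eq_square algebra_simps)
    also have "\<dots> \<le> (\<delta> / 2)\<^sup>2"
      using e\<delta> by (simp add: power_divide)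
    finally have diff: "L2_set (\<lambda>C. \<phi> (g <# C) - \<phi> C) Z \<le> \<delta> / 2"
      unfolding L2_set_def using \<delta> by (intro real_le_lsqrt) auto
    have "L2_set \<phi> Z = 1" using norm1 by (simp add: L2_set_def)
    then have sum: "L2_set (\<lambda>C. \<phi> (g <# C) + \<phi> C) Z \<le> 2"
      using L2_set_triangle_ineq[of "\<lambda>C. \<phi> (g <# C)" \<phi> Z] L2_shift[OF g] by linarith
    have "(\<Sum>C\<in>Z. \<bar>(\<phi> (g <# C))\<^sup>2 - (\<phi> C)\<^sup>2\<bar>)
        = (\<Sum>C\<in>Z. \<bar>\<phi> (g <# C) - \<phi> C\<bar> * \<bar>\<phi> (g <# C) + \<phi> C\<bar>)"
      by (simp add: abs_mult[symmetric] power2_eq_square algebra_simps)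
    also have "\<dots> \<le> L2_set (\<lambda>C. \<phi> (g <# C) - \<phi> C) Z * L2_set (\<lambda>C. \<phi> (g <# C) + \<phi> C) Z"
      by (rule L2_set_mult_ineq)
    also have "\<dots> \<le> \<delta> / 2 * 2"
      using diff sum \<delta> by (intro mult_mono) (auto simp: L2_set_nonneg)
    finally show ?thesis by simp
  qed
  then have "almost_invariant_measure H F \<delta> Z (\<lambda>C. (\<phi> C)\<^sup>2)"
    using Z supp norm1 by (auto simp: almost_invariant_measure_def)
  then show thesis by (rule that)
qed

section \<open>The diagonal action on pairs of cosets\<close>

text \<open>
  Replacing \<open>sqrt (a i)\<close> by \<open>sqrt c\<close> in the square costs an error that is linear in \<open>\<bar>a i - c\<bar>\<close>, because
  \<open>sqrt c * \<bar>sqrt (a i) - sqrt c\<bar> \<le> \<bar>a i - c\<bar>\<close>. This lets the \<open>\<ell>\<^sup>1\<close> condition on \<open>\<nu>\<close> control the vector \<open>sqrt \<nu>\<close>.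
\<close>
lemma weighted_square_sum_lower_bound:
  fixes a f :: "'i \<Rightarrow> real"
  assumes f: "\<And>i. i \<in> I \<Longrightarrow> 0 \<le> f i" and a: "\<And>i. i \<in> I \<Longrightarrow> 0 \<le> a i" and c: "0 \<le> c"
  shows "c * (\<Sum>i\<in>I. f i)\<^sup>2 - 2 * (\<Sum>i\<in>I. f i) * (\<Sum>i\<in>I. \<bar>a i - c\<bar> * f i)
     \<le> (\<Sum>i\<in>I. sqrt (a i) * f i)\<^sup>2"
proof -
  define u where "u = (\<Sum>i\<in>I. f i)"
  define x where "x = sqrt c * u"
  define y where "y = (\<Sum>i\<in>I. sqrt (a i) * f i)"
  have u: "0 \<le> u" using f by (simp add: u_def sum_nonneg)
  have "x - y = (\<Sum>i\<in>I. (sqrt c - sqrt (a i)) * f i)"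
    by (simp add: x_def y_def u_def sum_distrib_left sum_subtractf algebra_simps)
  then have "sqrt c * (x - y) = (\<Sum>i\<in>I. sqrt c * (sqrt c - sqrt (a i)) * f i)"
    by (simp add: sum_distrib_left mult.assoc)
  also have "\<dots> \<le> (\<Sum>i\<in>I. \<bar>a i - c\<bar> * f i)"
  proof (intro sum_mono mult_right_mono f)
    fix i assume i: "i \<in> I"
    have "sqrt c * (sqrt c - sqrt (a i)) \<le> (sqrt c + sqrt (a i)) * \<bar>sqrt c - sqrt (a i)\<bar>"
      using a[OF i] c by (intro order.trans[OF mult_left_mono[OF abs_ge_self] mult_right_mono]) auto
    also have "\<dots> = \<bar>(sqrt c + sqrt (a i)) * (sqrt c - sqrt (a i))\<bar>"
      using a[OF i] c by (simp add: abs_mult)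
    also have "(sqrt c + sqrt (a i)) * (sqrt c - sqrt (a i)) = c - a i"
      using a[OF i] c by (simp add: algebra_simps)
    finally show "sqrt c * (sqrt c - sqrt (a i)) \<le> \<bar>a i - c\<bar>" by simp
  qed
  finally have "u * (sqrt c * (x - y)) \<le> u * (\<Sum>i\<in>I. \<bar>a i - c\<bar> * f i)"
    using u by (rule mult_left_mono)
  then have "x * (x - y) \<le> u * (\<Sum>i\<in>I. \<bar>a i - c\<bar> * f i)"
    by (simp add: x_def mult_ac)
  moreover have "x\<^sup>2 = c * u\<^sup>2" using c by (simp add: x_def power_mult_distrib)
  moreover have "x\<^sup>2 - 2 * (x * (x - y)) \<le> y\<^sup>2"
    using zero_le_power2[of "x - y"] by (simp add: power2_eq_square algebra_simps)
  ultimately show ?thesis by (simp add: u_def y_def)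
qed

text \<open>
  The pairs of cosets whose joint stabilizer satisfies the bound \<open>t\<close> form an invariant set, because
  translating a pair conjugates its stabilizer. Every orbit in it satisfies the bound \<open>t\<close>, hence so
  does the whole set.
\<close>
lemma (in group) set_action_bounded_pairs:
  fixes t :: real
  assumes S: "finite S" "S \<subseteq> carrier G" and H: "subgroup H G" and H1: "subgroup H1 G"
  defines "B \<equiv> (\<lambda>D. {C \<in> lcosets H1.
      averaging_bound S (l_coset G) (lcosets (coset_stab C \<inter> coset_stab D)) t})"
  shows "set_action G (SIGMA D:lcosets H. B D) (\<lambda>g (D, C). (g <# D, g <# C))"
    and "averaging_bound S (\<lambda>g (D, C). (g <# D, g <# C)) (SIGMA D:lcosets H. B D) t"
proof -
  interpret H: set_action G "lcosets H" "l_coset G" using H by (rule set_action_lcosets)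
  interpret H1: set_action G "lcosets H1" "l_coset G" using H1 by (rule set_action_lcosets)
  have inv: "g <# C \<in> B (g <# D)" if g: "g \<in> carrier G" and D: "D \<in> lcosets H" and C: "C \<in> B D" for g C D
  proof -
    have C': "C \<in> lcosets H1" using C by (simp add: B_def)
    have "coset_stab (g <# C) \<inter> coset_stab (g <# D)
        = conjugate_subgroup G g (coset_stab C \<inter> coset_stab D)"
      using coset_stab_translate[OF H1 g C'] coset_stab_translate[OF H g D] g
      by (subst conjugate_subgroup_Int) auto
    moreover have "subgroup (coset_stab C \<inter> coset_stab D) G"
      using subgroup_coset_stab[OF H1 C'] subgroup_coset_stab[OF H D]
      by (rule subgroups_Inter_pair)
    ultimately show ?thesis
      using averaging_bound_conjugate[OF S _ g] C g H1.act_closed by (auto simp: B_def)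
  qed
  show act: "set_action G (SIGMA D:lcosets H. B D) (\<lambda>g (D, C). (g <# D, g <# C))"
  proof unfold_locales
    show "(case x of (D, C) \<Rightarrow> (g <# D, g <# C)) \<in> (SIGMA D:lcosets H. B D)"
      if "g \<in> carrier G" "x \<in> (SIGMA D:lcosets H. B D)" for g x
      using that inv H.act_closed by auto
    show "(case x of (D, C) \<Rightarrow> (\<one> <# D, \<one> <# C)) = x"
      if "x \<in> (SIGMA D:lcosets H. B D)" for x
      using that H.act_one H1.act_one by (auto simp: B_def)
    show "(case x of (D, C) \<Rightarrow> ((g \<otimes> h) <# D, (g \<otimes> h) <# C)) =
        (case case x of (D, C) \<Rightarrow> (h <# D, h <# C) of (D, C) \<Rightarrow> (g <# D, g <# C))"
      if "g \<in> carrier G" "h \<in> carrier G" "x \<in> (SIGMA D:lcosets H. B D)" for g h x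
      using that H.act_mult H1.act_mult by (auto simp: B_def)
  qed
  interpret P: set_action G "SIGMA D:lcosets H. B D" "\<lambda>g (D, C). (g <# D, g <# C)" by (rule act)
  show "averaging_bound S (\<lambda>g (D, C). (g <# D, g <# C)) (SIGMA D:lcosets H. B D) t"
  proof (rule P.averaging_bound_stabilizers[OF S])
    fix x assume "x \<in> (SIGMA D:lcosets H. B D)"
    then obtain D C where x: "x = (D, C)" "C \<in> B D" by auto
    have "P.stab x = coset_stab C \<inter> coset_stab D" by (auto simp: P.stab_def x(1))
    with x(2) show "averaging_bound S (l_coset G) (lcosets (P.stab x)) t" by (simp add: B_def)
  qed
qed

text \<open>
  If \<open>H\<close> violates the bound \<open>t\<close>, witnessed by \<open>\<phi>\<close>, then the set of cosets \<open>C\<close> of \<open>H1\<close> for which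
  \<open>coset_stab C \<inter> H\<close> satisfies it has small mass for every almost invariant \<open>\<nu>\<close>. Indeed, restrict the
  vector \<open>(D, C) \<mapsto> sqrt (\<nu> C) * \<phi> D\<close> to the invariant set of pairs satisfying the bound. As \<open>\<nu>\<close> is almost
  invariant, the slices of this set over the finitely many relevant \<open>D\<close> have nearly the same
  mass \<open>h\<close>, and averaging acts almost only on the factor \<open>\<phi>\<close>. So the restricted vector violates the
  bound by nearly \<open>h\<close> times the violation of \<open>\<phi>\<close>, which forces \<open>h\<close> to be small.
\<close>
lemma (in group) bounded_mass_bound:
  assumes S: "finite S" "S \<subseteq> carrier G" and H: "subgroup H G" and H1: "subgroup H1 G"
    and nb: "\<not> averaging_bound S (l_coset G) (lcosets H) t"
  shows "\<exists>F K. finite F \<and> F \<subseteq> carrier G \<and>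
    (\<forall>Z \<nu> \<delta>. almost_invariant_measure H1 F \<delta> Z \<nu> \<longrightarrow>
       (\<Sum>C | C \<in> Z \<and> averaging_bound S (l_coset G) (lcosets (coset_stab C \<inter> H)) t. \<nu> C) \<le> K * \<delta>)"
proof -
  interpret H: set_action G "lcosets H" "l_coset G" using H by (rule set_action_lcosets)
  interpret H1: set_action G "lcosets H1" "l_coset G" using H1 by (rule set_action_lcosets)
  define B where "B D = {C \<in> lcosets H1.
      averaging_bound S (l_coset G) (lcosets (coset_stab C \<inter> coset_stab D)) t}" for D
  let ?act = "\<lambda>g (D, C). (g <# D, g <# C)"
  interpret P: set_action G "SIGMA D:lcosets H. B D" ?act
    unfolding B_def by (rule set_action_bounded_pairs(1)[OF S H H1])
  have pairs: "averaging_bound S ?act (SIGMA D:lcosets H. B D) t"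
    unfolding B_def by (rule set_action_bounded_pairs(2)[OF S H H1])
  have B_act: "g <# C \<in> B (g <# D)" if "g \<in> carrier G" "D \<in> lcosets H" "C \<in> B D" for g C D
    using P.act_closed[of g "(D, C)"] that by simp
  define T where "T = t * real (card S)"
  obtain Y \<phi> where Y: "finite Y" "Y \<subseteq> lcosets H" and pos: "\<And>D. (0::real) \<le> \<phi> D"
    and gt: "T\<^sup>2 * (\<Sum>D\<in>(\<Union>s\<in>S. l_coset G s ` Y). (\<phi> D)\<^sup>2) < (\<Sum>D\<in>Y. (\<Sum>s\<in>S. \<phi> (s <# D))\<^sup>2)"
    using nb unfolding averaging_bound_def T_def by (auto simp: not_le)
  define W where "W = (\<Union>s\<in>S. l_coset G s ` Y)"
  define u where "u D = (\<Sum>s\<in>S. \<phi> (s <# D))" for D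
  define U where "U = (\<Sum>D\<in>Y. (u D)\<^sup>2)"
  define \<Phi> where "\<Phi> = (\<Sum>D\<in>W. (\<phi> D)\<^sup>2)"
  have gap: "0 < U - T\<^sup>2 * \<Phi>" using gt by (simp add: U_def \<Phi>_def u_def W_def)
  have W: "finite W" "W \<subseteq> lcosets H" using S Y H.act_closed by (auto simp: W_def)
  have u0: "0 \<le> u D" for D using pos by (simp add: u_def sum_nonneg)
  have "\<forall>D\<in>lcosets H. \<exists>a. a \<in> carrier G \<and> D = a <# H" by (auto simp: LCOSETS_def)
  then obtain r where r: "\<And>D. D \<in> lcosets H \<Longrightarrow> r D \<in> carrier G \<and> D = r D <# H" by metis
  define F where "F = S \<union> r ` Y \<union> (\<lambda>D. inv (r D)) ` W"
  define K where "K = (3 * U + T\<^sup>2 * \<Phi>) / (U - T\<^sup>2 * \<Phi>)"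
  show ?thesis
  proof (rule exI[of _ F], rule exI[of _ K], intro conjI allI impI)
    show "finite F" using S Y W by (simp add: F_def)
    show F: "F \<subseteq> carrier G" using S Y W r by (auto simp: F_def)
    fix Z \<nu> \<delta>
    assume "almost_invariant_measure H1 F \<delta> Z \<nu>"
    then have Z: "finite Z" "Z \<subseteq> lcosets H1" and \<nu>0: "\<And>C. 0 \<le> \<nu> C"
      and supp: "\<And>C. C \<notin> Z \<Longrightarrow> \<nu> C = 0"
      and inv: "\<And>g. g \<in> F \<Longrightarrow> (\<Sum>C\<in>Z. \<bar>\<nu> (g <# C) - \<nu> C\<bar>) \<le> \<delta>"
      by (simp_all add: almost_invariant_measure_def)
    define h where "h D = (\<Sum>C\<in>Z \<inter> B D. \<nu> C)" for D
    have Zfin: "finite (Z \<inter> B D)" for D using Z by simp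
    have h_move: "h D - \<delta> \<le> h (g <# D)" if g: "g \<in> F" and D: "D \<in> lcosets H" for g D
    proof -
      have gc: "g \<in> carrier G" using F g by auto
      have inj: "inj_on (l_coset G g) (Z \<inter> B D)"
        using Z by (intro inj_on_subset[OF H1.inj_on_act[OF gc]]) auto
      have "h D - (\<Sum>C\<in>Z \<inter> B D. \<nu> (g <# C)) = (\<Sum>C\<in>Z \<inter> B D. \<nu> C - \<nu> (g <# C))"
        by (simp add: h_def sum_subtractf)
      also have "\<dots> \<le> (\<Sum>C\<in>Z \<inter> B D. \<bar>\<nu> (g <# C) - \<nu> C\<bar>)" by (intro sum_mono) auto
      also have "\<dots> \<le> (\<Sum>C\<in>Z. \<bar>\<nu> (g <# C) - \<nu> C\<bar>)" using Z by (intro sum_mono2) auto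
      also have "\<dots> \<le> \<delta>" using g by (rule inv)
      finally have "h D - \<delta> \<le> (\<Sum>C\<in>Z \<inter> B D. \<nu> (g <# C))" by simp
      also have "\<dots> = (\<Sum>C\<in>l_coset G g ` (Z \<inter> B D). \<nu> C)"
        using inj by (simp add: sum.reindex)
      also have "\<dots> = (\<Sum>C\<in>l_coset G g ` (Z \<inter> B D) \<inter> Z. \<nu> C)"
        using Zfin supp by (intro sum.mono_neutral_right) auto
      also have "\<dots> \<le> h (g <# D)"
        unfolding h_def using Zfin \<nu>0 B_act[OF gc D] by (intro sum_mono2) auto
      finally show ?thesis .
    qed
    have hY: "h H - \<delta> \<le> h D" if D: "D \<in> Y" for D
      using h_move[of "r D" H] r[of D] D Y self_in_lcosets[OF H] by (auto simp: F_def)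
    have hW: "h D \<le> h H + \<delta>" if D: "D \<in> W" for D
    proof -
      have "inv (r D) <# D = H"
        using r[of D] D W(2) H.act_inv_act[of "r D" H] self_in_lcosets[OF H] by auto
      with h_move[of "inv (r D)" D] D W(2) show ?thesis by (auto simp: F_def)
    qed
    define \<psi> where "\<psi> = (\<lambda>(D, C). sqrt (\<nu> C) * \<phi> D)"
    define Q where "Q = (SIGMA D:Y. Z \<inter> B D)"
    have Q: "finite Q" "Q \<subseteq> (SIGMA D:lcosets H. B D)" using Y Z by (auto simp: Q_def)
    let ?A = "\<Union>s\<in>S. ?act s ` Q"
    have A: "finite ?A" using S Q by simp
    have A_sub: "?A \<subseteq> (SIGMA D:W. B D)"
    proof
      fix z assume "z \<in> ?A"
      then obtain s D C where z: "s \<in> S" "D \<in> Y" "C \<in> B D" "z = (s <# D, s <# C)"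
        by (auto simp: Q_def)
      then show "z \<in> (SIGMA D:W. B D)" using B_act[of s D C] S Y by (auto simp: W_def)
    qed
    have "(\<Sum>z\<in>?A. (\<psi> z)\<^sup>2) = (\<Sum>z\<in>?A \<inter> (SIGMA D:W. Z \<inter> B D). (\<psi> z)\<^sup>2)"
    proof (rule sum.mono_neutral_right)
      show "\<forall>z\<in>?A - ?A \<inter> (SIGMA D:W. Z \<inter> B D). (\<psi> z)\<^sup>2 = 0"
      proof
        fix z assume z: "z \<in> ?A - ?A \<inter> (SIGMA D:W. Z \<inter> B D)"
        obtain D C where DC: "z = (D, C)" by (cases z)
        have "z \<in> (SIGMA D:W. B D)" "z \<notin> (SIGMA D:W. Z \<inter> B D)"
          using z A_sub by blast+
        then have "C \<notin> Z" by (simp add: DC)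
        then show "(\<psi> z)\<^sup>2 = 0" using supp by (simp add: DC \<psi>_def)
      qed
    qed (use A in auto)
    also have "\<dots> \<le> (\<Sum>z\<in>(SIGMA D:W. Z \<inter> B D). (\<psi> z)\<^sup>2)"
      using W Z by (intro sum_mono2) auto
    also have "\<dots> = (\<Sum>D\<in>W. \<Sum>C\<in>Z \<inter> B D. \<nu> C * (\<phi> D)\<^sup>2)"
      using W Z \<nu>0 by (subst sum.Sigma) (auto simp: \<psi>_def power_mult_distrib intro!: sum.cong)
    also have "\<dots> = (\<Sum>D\<in>W. h D * (\<phi> D)\<^sup>2)"
      by (simp add: h_def sum_distrib_right)
    also have "\<dots> \<le> (\<Sum>D\<in>W. (h H + \<delta>) * (\<phi> D)\<^sup>2)"
      using hW by (intro sum_mono mult_right_mono) auto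
    also have "\<dots> = (h H + \<delta>) * \<Phi>" by (simp add: \<Phi>_def sum_distrib_left)
    finally have upper: "(\<Sum>z\<in>?A. (\<psi> z)\<^sup>2) \<le> (h H + \<delta>) * \<Phi>" .
    \<comment> \<open>One \<open>\<delta>\<close> is lost by comparing \<open>h D\<close> with \<open>h H\<close>, two by treating \<open>\<nu>\<close> as invariant.\<close>
    have slice: "(h H - 3 * \<delta>) * (u D)\<^sup>2 \<le> (\<Sum>C\<in>Z \<inter> B D. (\<Sum>s\<in>S. \<psi> (?act s (D, C)))\<^sup>2)"
      if D: "D \<in> Y" for D
    proof -
      have "(\<Sum>C\<in>Z \<inter> B D. \<Sum>s\<in>S. \<bar>\<nu> (s <# C) - \<nu> C\<bar> * \<phi> (s <# D))
          = (\<Sum>s\<in>S. (\<Sum>C\<in>Z \<inter> B D. \<bar>\<nu> (s <# C) - \<nu> C\<bar>) * \<phi> (s <# D))"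
        by (subst sum.swap) (simp add: sum_distrib_right)
      also have "\<dots> \<le> (\<Sum>s\<in>S. \<delta> * \<phi> (s <# D))"
      proof (intro sum_mono mult_right_mono pos)
        fix s assume "s \<in> S"
        have "(\<Sum>C\<in>Z \<inter> B D. \<bar>\<nu> (s <# C) - \<nu> C\<bar>) \<le> (\<Sum>C\<in>Z. \<bar>\<nu> (s <# C) - \<nu> C\<bar>)"
          using Z by (intro sum_mono2) auto
        also have "\<dots> \<le> \<delta>" using \<open>s \<in> S\<close> by (intro inv) (simp add: F_def)
        finally show "(\<Sum>C\<in>Z \<inter> B D. \<bar>\<nu> (s <# C) - \<nu> C\<bar>) \<le> \<delta>" .
      qed
      also have "\<dots> = \<delta> * u D" by (simp add: u_def sum_distrib_left)
      finally have "2 * u D * (\<Sum>C\<in>Z \<inter> B D. \<Sum>s\<in>S. \<bar>\<nu> (s <# C) - \<nu> C\<bar> * \<phi> (s <# D))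
          \<le> 2 * u D * (\<delta> * u D)"
        using u0 by (intro mult_left_mono) auto
      moreover have "(h H - \<delta>) * (u D)\<^sup>2 \<le> h D * (u D)\<^sup>2"
        using hY[OF D] by (rule mult_right_mono) simp
      ultimately have "(h H - 3 * \<delta>) * (u D)\<^sup>2
          \<le> h D * (u D)\<^sup>2 - 2 * u D * (\<Sum>C\<in>Z \<inter> B D. \<Sum>s\<in>S. \<bar>\<nu> (s <# C) - \<nu> C\<bar> * \<phi> (s <# D))"
        by (simp add: power2_eq_square algebra_simps)
      also have "\<dots> = (\<Sum>C\<in>Z \<inter> B D. \<nu> C * (u D)\<^sup>2
          - 2 * u D * (\<Sum>s\<in>S. \<bar>\<nu> (s <# C) - \<nu> C\<bar> * \<phi> (s <# D)))"
        by (simp add: h_def sum_subtractf sum_distrib_right sum_distrib_left)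
      also have "\<dots> \<le> (\<Sum>C\<in>Z \<inter> B D. (\<Sum>s\<in>S. sqrt (\<nu> (s <# C)) * \<phi> (s <# D))\<^sup>2)"
        unfolding u_def using pos \<nu>0 by (intro sum_mono weighted_square_sum_lower_bound) auto
      finally show ?thesis by (simp add: \<psi>_def)
    qed
    have "(h H - 3 * \<delta>) * U \<le> (\<Sum>D\<in>Y. \<Sum>C\<in>Z \<inter> B D. (\<Sum>s\<in>S. \<psi> (?act s (D, C)))\<^sup>2)"
      unfolding U_def sum_distrib_left using slice by (rule sum_mono)
    also have "\<dots> = (\<Sum>z\<in>Q. (\<Sum>s\<in>S. \<psi> (?act s z))\<^sup>2)"
      unfolding Q_def using Y Z by (subst sum.Sigma) (auto simp: case_prod_unfold)
    also have "\<dots> \<le> T\<^sup>2 * (\<Sum>z\<in>?A. (\<psi> z)\<^sup>2)"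
      unfolding T_def using Q pos \<nu>0 by (intro averaging_boundD[OF pairs]) (auto simp: \<psi>_def)
    also have "\<dots> \<le> T\<^sup>2 * ((h H + \<delta>) * \<Phi>)"
      using upper by (intro mult_left_mono) auto
    finally have "h H * (U - T\<^sup>2 * \<Phi>) \<le> (3 * U + T\<^sup>2 * \<Phi>) * \<delta>"
      by (simp add: algebra_simps)
    then have "h H \<le> K * \<delta>"
      using gap by (simp add: K_def field_simps)
    moreover have "{C \<in> Z. averaging_bound S (l_coset G) (lcosets (coset_stab C \<inter> H)) t} = Z \<inter> B H"
      using Z coset_stab_subgroup[OF H] by (auto simp: B_def)
    ultimately show "(\<Sum>C | C \<in> Z \<and> averaging_bound S (l_coset G) (lcosets (coset_stab C \<inter> H)) t. \<nu> C)
        \<le> K * \<delta>"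
      by (simp add: h_def)
  qed
qed

section \<open>Measurability on the space of subgroups\<close>

lemma topspace_subgroup_topology: "topspace (subgroup_topology G) = {H. subgroup H G}"
  by (auto simp: subgroup_topology_def topspace_pullback_topology)

lemma opens_subset_Pow_subgroups: "{U. openin (subgroup_topology G) U} \<subseteq> Pow {H. subgroup H G}"
  using openin_subset[of "subgroup_topology G"] by (auto simp: topspace_subgroup_topology)

lemma space_subgroup_borel: "space (subgroup_borel G) = {H. subgroup H G}"
  unfolding subgroup_borel_def by (rule space_measure_of) (rule opens_subset_Pow_subgroups)

lemma open_in_sets_subgroup_borel: "openin (subgroup_topology G) U \<Longrightarrow> U \<in> sets (subgroup_borel G)"
  unfolding subgroup_borel_def
  by (rule in_measure_of[OF opens_subset_Pow_subgroups]) simp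

lemma openin_subgroups_containing:
  assumes F: "finite F" "F \<subseteq> carrier G"
  shows "openin (subgroup_topology G) {H. subgroup H G \<and> F \<subseteq> H}"
proof -
  let ?V = "PiE (carrier G) (\<lambda>g. if g \<in> F then {True} else UNIV)"
  have "finite {g \<in> carrier G. (if g \<in> F then {True} else UNIV) \<noteq> topspace (discrete_topology (UNIV :: bool set))}"
    using F by (auto intro: finite_subset[of _ F])
  then have "openin (product_topology (\<lambda>_. discrete_topology (UNIV :: bool set)) (carrier G)) ?V"
    by (subst openin_PiE_gen) auto
  moreover have "{H. subgroup H G \<and> F \<subseteq> H} = (\<lambda>H. \<lambda>g\<in>carrier G. g \<in> H) -` ?V \<inter> {H. subgroup H G}"
    using F(2) by (auto simp: PiE_iff subset_iff split: if_splits)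
  ultimately show ?thesis
    unfolding subgroup_topology_def openin_pullback_topology by blast
qed

text \<open>
  Such a function is lower semicontinuous, even for the coarser topology that only tests whether
  finitely many elements belong to the subgroup.
\<close>
lemma borel_measurable_subgroup_function:
  fixes f :: "'a set \<Rightarrow> real"
  assumes lsc: "\<And>a H. subgroup H G \<Longrightarrow> a < f H \<Longrightarrow>
      \<exists>F. finite F \<and> F \<subseteq> H \<and> (\<forall>K. subgroup K G \<longrightarrow> F \<subseteq> K \<longrightarrow> a < f K)"
  shows "f \<in> borel_measurable (subgroup_borel G)"
  unfolding borel_measurable_iff_greater
proof
  fix a
  have "openin (subgroup_topology G) {H. subgroup H G \<and> a < f H}"
  proof (subst openin_subopen, rule ballI)
    fix H assume "H \<in> {H. subgroup H G \<and> a < f H}"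
    then have H: "subgroup H G" "a < f H" by auto
    from lsc[OF this] obtain F
      where F: "finite F" "F \<subseteq> H" and up: "\<And>K. subgroup K G \<Longrightarrow> F \<subseteq> K \<Longrightarrow> a < f K"
      by blast
    have "openin (subgroup_topology G) {K. subgroup K G \<and> F \<subseteq> K}"
      using F subgroup.subset[OF H(1)] by (intro openin_subgroups_containing) auto
    then show "\<exists>T. openin (subgroup_topology G) T \<and> H \<in> T \<and> T \<subseteq> {H. subgroup H G \<and> a < f H}"
      using H F up by blast
  qed
  then show "{H \<in> space (subgroup_borel G). a < f H} \<in> sets (subgroup_borel G)"
    by (simp add: open_in_sets_subgroup_borel space_subgroup_borel)
qed

lemma continuous_map_membership:
  assumes "b \<in> carrier G"
  shows "continuous_map (subgroup_topology G) (discrete_topology UNIV) (\<lambda>H. b \<in> H)"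
proof -
  let ?\<iota> = "\<lambda>H. \<lambda>g\<in>carrier G. g \<in> H"
  have "continuous_map (subgroup_topology G) (discrete_topology (UNIV :: bool set)) ((\<lambda>x. x b) \<circ> ?\<iota>)"
    unfolding subgroup_topology_def
    by (intro continuous_map_pullback continuous_map_product_projection assms)
  with assms show ?thesis by (simp add: comp_def)
qed

lemma (in group) continuous_map_conjugate_subgroup:
  assumes g: "g \<in> carrier G"
  shows "continuous_map (subgroup_topology G) (subgroup_topology G) (conjugate_subgroup G g)"
proof -
  let ?\<iota> = "\<lambda>H. \<lambda>a\<in>carrier G. a \<in> H"
  have "continuous_map (subgroup_topology G)
      (product_topology (\<lambda>_. discrete_topology (UNIV :: bool set)) (carrier G))
      (?\<iota> \<circ> conjugate_subgroup G g)"
    unfolding continuous_map_componentwise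
  proof (intro conjI ballI)
    fix a assume a: "a \<in> carrier G"
    show "continuous_map (subgroup_topology G) (discrete_topology (UNIV :: bool set))
        (\<lambda>H. (?\<iota> \<circ> conjugate_subgroup G g) H a)"
    proof (rule continuous_map_eq)
      show "continuous_map (subgroup_topology G) (discrete_topology UNIV) (\<lambda>H. inv g \<otimes> a \<otimes> g \<in> H)"
        using a g by (intro continuous_map_membership) simp
      fix H assume "H \<in> topspace (subgroup_topology G)"
      then have "H \<subseteq> carrier G" by (simp add: topspace_subgroup_topology subgroup.subset)
      then show "(inv g \<otimes> a \<otimes> g \<in> H) = (?\<iota> \<circ> conjugate_subgroup G g) H a"
        using a g by (simp add: conjugate_subgroup_iff)
    qed
  qed auto
  then show ?thesis
    using g subgroup_conjugate_subgroup unfolding subgroup_topology_def[of G]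
    by (intro continuous_map_pullback')
      (auto simp: topspace_subgroup_topology subgroup_topology_def[of G, symmetric])
qed

lemma (in group) measurable_conjugate_subgroup:
  assumes g: "g \<in> carrier G"
  shows "conjugate_subgroup G g \<in> measurable (subgroup_borel G) (subgroup_borel G)"
proof (subst (2) subgroup_borel_def, rule measurable_measure_of[OF opens_subset_Pow_subgroups])
  show "conjugate_subgroup G g \<in> space (subgroup_borel G) \<rightarrow> {H. subgroup H G}"
    using g subgroup_conjugate_subgroup by (auto simp: space_subgroup_borel)
  fix U assume "U \<in> {U. openin (subgroup_topology G) U}"
  then have "openin (subgroup_topology G) {H \<in> topspace (subgroup_topology G). conjugate_subgroup G g H \<in> U}"
    using continuous_map_conjugate_subgroup[OF g] by (simp add: continuous_map)
  moreover have "{H \<in> topspace (subgroup_topology G). conjugate_subgroup G g H \<in> U}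
      = conjugate_subgroup G g -` U \<inter> space (subgroup_borel G)"
    by (auto simp: topspace_subgroup_topology space_subgroup_borel)
  ultimately show "conjugate_subgroup G g -` U \<inter> space (subgroup_borel G) \<in> sets (subgroup_borel G)"
    by (simp add: open_in_sets_subgroup_borel)
qed

lemma (in group) cospectral_radius_lower_semicontinuous:
  assumes S: "finite S" "S \<noteq> {}" "S \<subseteq> carrier G" and H: "subgroup H G"
    and a: "a < cospectral_radius G S H"
  shows "\<exists>F. finite F \<and> F \<subseteq> H \<and> (\<forall>K. subgroup K G \<longrightarrow> F \<subseteq> K \<longrightarrow> a < cospectral_radius G S K)"
proof (cases "0 \<le> a")
  case True
  then have "\<not> averaging_bound S (l_coset G) (lcosets H) a"
    using a cospectral_radius_le_iff[OF S H True] by simp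
  then obtain F where "finite F" "F \<subseteq> H"
    and F: "\<And>K. subgroup K G \<Longrightarrow> F \<subseteq> K \<Longrightarrow> \<not> averaging_bound S (l_coset G) (lcosets K) a"
    using averaging_bound_open[OF S(1,3) H] by blast
  moreover have "a < cospectral_radius G S K" if "subgroup K G" "F \<subseteq> K" for K
    using F[OF that] cospectral_radius_le_iff[OF S that(1) True] by simp
  ultimately show ?thesis by blast
next
  case False
  then have "a < cospectral_radius G S K" if "subgroup K G" for K
    using cospectral_radius_nonneg[OF S that] by linarith
  then show ?thesis by (intro exI[of _ "{}"]) auto
qed

lemma (in group) measurable_cospectral_radius_Int:
  assumes S: "finite S" "S \<noteq> {}" "S \<subseteq> carrier G" and L: "subgroup L G"
  shows "(\<lambda>H. cospectral_radius G S (L \<inter> H)) \<in> borel_measurable (subgroup_borel G)"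
proof (rule borel_measurable_subgroup_function)
  fix a H assume H: "subgroup H G" and a: "a < cospectral_radius G S (L \<inter> H)"
  then obtain F where F: "finite F" "F \<subseteq> L \<inter> H"
    and up: "\<And>K. subgroup K G \<Longrightarrow> F \<subseteq> K \<Longrightarrow> a < cospectral_radius G S K"
    using cospectral_radius_lower_semicontinuous[OF S subgroups_Inter_pair[OF L H] a] by blast
  then show "\<exists>F. finite F \<and> F \<subseteq> H \<and>
      (\<forall>K. subgroup K G \<longrightarrow> F \<subseteq> K \<longrightarrow> a < cospectral_radius G S (L \<inter> K))"
    using subgroups_Inter_pair[OF L] by (intro exI[of _ F]) auto
qed

lemma (in group) measurable_cospectral_radius:
  assumes S: "finite S" "S \<noteq> {}" "S \<subseteq> carrier G"
  shows "cospectral_radius G S \<in> borel_measurable (subgroup_borel G)"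
  by (rule borel_measurable_subgroup_function) (rule cospectral_radius_lower_semicontinuous[OF S])

section \<open>Invariant random subgroups\<close>

text \<open>
  The constant is the mean: the events of lying above and below it have probability 0 or 1, and
  neither can have probability 1.
\<close>
lemma (in group) ergodic_invariant_function_AE_constant:
  fixes f :: "'a set \<Rightarrow> real"
  assumes "prob_space \<mu>" and sets: "sets \<mu> = sets (subgroup_borel G)"
    and ergodic: "conjugation_ergodic_measure G \<mu>"
    and f: "f \<in> borel_measurable (subgroup_borel G)"
    and bounded: "\<And>H. subgroup H G \<Longrightarrow> \<bar>f H\<bar> \<le> b"
    and invariant: "\<And>g H. g \<in> carrier G \<Longrightarrow> subgroup H G \<Longrightarrow> f (conjugate_subgroup G g H) = f H"
  obtains c where "AE H in \<mu>. f H = c"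
proof
  interpret prob_space \<mu> by fact
  have space: "space \<mu> = {H. subgroup H G}"
    using sets_eq_imp_space_eq[OF sets] by (simp add: space_subgroup_borel)
  have f\<mu>[measurable]: "f \<in> borel_measurable \<mu>" using f sets by (simp cong: measurable_cong_sets)
  have int: "integrable \<mu> f"
    by (rule integrable_const_bound[where B = b]) (use bounded in \<open>auto simp: space\<close>)
  have zero_one: "prob {H \<in> space \<mu>. Q (f H)} = 0 \<or> prob {H \<in> space \<mu>. Q (f H)} = 1"
    if "{H \<in> space \<mu>. Q (f H)} \<in> sets \<mu>" for Q
  proof -
    have "conjugate_subgroup G g -` {H \<in> space \<mu>. Q (f H)} \<inter> space \<mu> = {H \<in> space \<mu>. Q (f H)}"
      if "g \<in> carrier G" for g
      using that invariant subgroup_conjugate_subgroup by (auto simp: space)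
    with that ergodic show ?thesis unfolding conjugation_ergodic_measure_def by blast
  qed
  let ?c = "expectation f"
  have nz: "emeasure \<mu> (space \<mu>) \<noteq> 0" by (simp add: emeasure_space_1)
  have "prob {H \<in> space \<mu>. ?c < f H} \<noteq> 1"
  proof
    assume "prob {H \<in> space \<mu>. ?c < f H} = 1"
    then have "AE H in \<mu>. ?c < f H" by (subst (asm) prob_Collect_eq_1) auto
    then have "expectation (\<lambda>_. ?c) < expectation f"
      by (intro integral_less_AE_space int nz) auto
    then show False by (simp add: prob_space)
  qed
  then have "AE H in \<mu>. \<not> ?c < f H"
    using zero_one[of "\<lambda>x. ?c < x"] by (subst prob_Collect_eq_0[symmetric]) auto
  moreover have "prob {H \<in> space \<mu>. f H < ?c} \<noteq> 1"
  proof
    assume "prob {H \<in> space \<mu>. f H < ?c} = 1"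
    then have "AE H in \<mu>. f H < ?c" by (subst (asm) prob_Collect_eq_1) auto
    then have "expectation f < expectation (\<lambda>_. ?c)"
      by (intro integral_less_AE_space int nz) auto
    then show False by (simp add: prob_space)
  qed
  then have "AE H in \<mu>. \<not> f H < ?c"
    using zero_one[of "\<lambda>x. x < ?c"] by (subst prob_Collect_eq_0[symmetric]) auto
  ultimately show "AE H in \<mu>. f H = ?c" by eventually_elim simp
qed

text \<open>
  Let \<open>A L\<close> be the event that \<open>L \<inter> H\<close> has co-spectral radius at most \<open>t\<close>, and \<open>\<nu> n\<close> a sequence of
  increasingly invariant measures on the cosets of \<open>L\<close>. The \<open>\<nu> n\<close>-mass \<open>h n H\<close> of the cosets \<open>C\<close> for
  which \<open>coset_stab C \<inter> H\<close> has co-spectral radius at most \<open>t\<close> has expectation exactly the probability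
  of \<open>A L\<close>: moving \<open>C\<close> to \<open>L\<close> replaces \<open>H\<close> by a conjugate, which has the same law. On the other hand
  \<open>h n H\<close> tends to 0 for almost every \<open>H\<close>. By dominated convergence \<open>A L\<close> is a null set.
\<close>
lemma (in group) AE_cospectral_radius_Int_gt:
  assumes S: "finite S" "S \<noteq> {}" "S \<subseteq> carrier G" and countable: "countable (carrier G)"
    and L: "subgroup L G" and co: "coamenable G L"
    and "prob_space \<mu>" and sets: "sets \<mu> = sets (subgroup_borel G)"
    and inv: "conjugation_invariant_measure G \<mu>"
    and gt: "AE H in \<mu>. t < cospectral_radius G S H"
  shows "AE H in \<mu>. t < cospectral_radius G S (L \<inter> H)"
proof (cases "0 \<le> t")
  interpret prob_space \<mu> by fact
  have space: "space \<mu> = {H. subgroup H G}"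
    using sets_eq_imp_space_eq[OF sets] by (simp add: space_subgroup_borel)
  case False
  have "t < cospectral_radius G S (L \<inter> H)" if "H \<in> space \<mu>" for H
    using cospectral_radius_nonneg[OF S subgroups_Inter_pair[OF L, of H]] that False
    by (simp add: space)
  then show ?thesis by (rule AE_I2)
next
  case t: True
  interpret prob_space \<mu> by fact
  have space: "space \<mu> = {H. subgroup H G}"
    using sets_eq_imp_space_eq[OF sets] by (simp add: space_subgroup_borel)
  define A where "A M = {H \<in> space \<mu>. cospectral_radius G S (M \<inter> H) \<le> t}" for M
  have A: "A M \<in> sets \<mu>" if "subgroup M G" for M
  proof -
    have "(\<lambda>H. cospectral_radius G S (M \<inter> H)) \<in> borel_measurable \<mu>"
      using measurable_cospectral_radius_Int[OF S that] sets by (simp cong: measurable_cong_sets)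
    then show ?thesis unfolding A_def by measurable
  qed
  \<comment> \<open>Invariance of the law enters here.\<close>
  have prob_A: "prob (A (coset_stab C)) = prob (A L)" if C: "C \<in> lcosets L" for C
  proof -
    obtain g where g: "g \<in> carrier G" "C = g <# L" using C by (auto simp: LCOSETS_def)
    have stab: "coset_stab C = conjugate_subgroup G g L"
      using coset_stab_l_coset[OF L g(1)] g(2) by simp
    have "conjugate_subgroup G g (L \<inter> conjugate_subgroup G (inv g) H) = coset_stab C \<inter> H"
      if H: "subgroup H G" for H
      using g subgroup.subset[OF L] subgroup.subset[OF H]
        subgroup.subset[OF subgroup_conjugate_subgroup[OF H, of "inv g"]]
      unfolding stab
      by (subst conjugate_subgroup_Int) (simp_all add: conjugate_subgroup_conjugate conjugate_subgroup_one)
    then have radius: "cospectral_radius G S (coset_stab C \<inter> H)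
        = cospectral_radius G S (L \<inter> conjugate_subgroup G (inv g) H)" if "subgroup H G" for H
      using cospectral_radius_conjugate[OF S subgroups_Inter_pair[OF L subgroup_conjugate_subgroup] g(1),
          of H "inv g"] that g(1) by simp
    have "A (coset_stab C) = conjugate_subgroup G (inv g) -` A L \<inter> space \<mu>"
      using g(1) radius subgroup_conjugate_subgroup[of _ "inv g"] by (auto simp: A_def space)
    moreover have "conjugate_subgroup G (inv g) \<in> measurable \<mu> (subgroup_borel G)"
      using measurable_conjugate_subgroup[of "inv g"] g(1) sets by (simp cong: measurable_cong_sets)
    ultimately have "prob (A (coset_stab C))
        = measure (distr \<mu> (subgroup_borel G) (conjugate_subgroup G (inv g))) (A L)"
      using A[OF L] sets by (simp add: measure_distr)
    also have "distr \<mu> (subgroup_borel G) (conjugate_subgroup G (inv g)) = \<mu>"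
      using inv g(1) by (simp add: conjugation_invariant_measure_def)
    finally show ?thesis .
  qed
  have carrier_range: "range (from_nat_into (carrier G)) = carrier G"
    using countable by (intro range_from_nat_into) auto
  \<comment> \<open>These sets exhaust the group, so invariance under any finite set holds for large \<open>n\<close>.\<close>
  let ?F = "\<lambda>n. from_nat_into (carrier G) ` {..<n}"
  have "\<exists>Z \<nu>. almost_invariant_measure L (?F n) (inverse (Suc n)) Z \<nu>" for n
  proof -
    have "finite (?F n)" "?F n \<subseteq> carrier G" using carrier_range by auto
    then show ?thesis
      by (rule coamenable_almost_invariant[OF L co, of _ "inverse (Suc n)"]) auto
  qed
  then obtain Z \<nu> where Z\<nu>: "\<And>n. almost_invariant_measure L (?F n) (inverse (Suc n)) (Z n) (\<nu> n)"
    by metis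
  then have Z: "\<And>n. finite (Z n)" "\<And>n. Z n \<subseteq> lcosets L"
    and \<nu>: "\<And>n C. 0 \<le> \<nu> n C" "\<And>n. (\<Sum>C\<in>Z n. \<nu> n C) = 1"
    by (simp_all add: almost_invariant_measure_def)
  define h where "h n H = (\<Sum>C\<in>Z n. \<nu> n C * indicator (A (coset_stab C)) H)" for n H
  have AC: "A (coset_stab C) \<in> sets \<mu>" if "C \<in> Z n" for C n
    using that Z(2)[of n] by (intro A subgroup_coset_stab[OF L]) auto
  have h_meas: "h n \<in> borel_measurable \<mu>" for n
    unfolding h_def using AC by measurable
  have h_int: "expectation (h n) = prob (A L)" for n
  proof -
    have "expectation (h n) = (\<Sum>C\<in>Z n. \<nu> n C * prob (A (coset_stab C)))"
      unfolding h_def using AC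
      by (subst Bochner_Integration.integral_sum) (auto simp: emeasure_eq_measure)
    also have "\<dots> = (\<Sum>C\<in>Z n. \<nu> n C * prob (A L))"
      using prob_A Z(2)[of n] by (intro sum.cong) auto
    also have "\<dots> = prob (A L)" by (simp add: sum_distrib_right[symmetric] \<nu>(2))
    finally show ?thesis .
  qed
  have h_nonneg: "0 \<le> h n H" for n H
    unfolding h_def by (intro sum_nonneg mult_nonneg_nonneg \<nu>(1)) auto
  have h_le: "h n H \<le> 1" for n H
  proof -
    have "h n H \<le> (\<Sum>C\<in>Z n. \<nu> n C)"
      unfolding h_def by (intro sum_mono mult_right_le_one_le \<nu>(1)) (auto simp: indicator_def)
    then show ?thesis by (simp add: \<nu>(2))
  qed
  have "AE H in \<mu>. (\<lambda>n. h n H) \<longlonglongrightarrow> 0"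
    using gt AE_space
  proof eventually_elim
    fix H assume tH: "t < cospectral_radius G S H" and "H \<in> space \<mu>"
    then have H: "subgroup H G" by (simp add: space)
    have nb: "\<not> averaging_bound S (l_coset G) (lcosets H) t"
      using tH cospectral_radius_le_iff[OF S H t] by simp
    obtain F K where F: "finite F" "F \<subseteq> carrier G" and mass:
      "\<forall>Z \<nu> \<delta>. almost_invariant_measure L F \<delta> Z \<nu> \<longrightarrow>
       (\<Sum>C | C \<in> Z \<and> averaging_bound S (l_coset G) (lcosets (coset_stab C \<inter> H)) t. \<nu> C) \<le> K * \<delta>"
      using bounded_mass_bound[OF S(1,3) H L nb] by (elim exE conjE)
    have "F \<subseteq> from_nat_into (carrier G) ` UNIV" using F(2) carrier_range by simp
    then obtain I where I: "finite I" "F = from_nat_into (carrier G) ` I"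
      using finite_subset_image[OF F(1)] by blast
    obtain N where N: "\<And>k. k \<in> I \<Longrightarrow> k < N"
      using finite_nat_set_iff_bounded[of I] I(1) by blast
    have bound: "h n H \<le> K * inverse (Suc n)" if n: "N \<le> n" for n
    proof -
      have "h n H = (\<Sum>C\<in>Z n. if averaging_bound S (l_coset G) (lcosets (coset_stab C \<inter> H)) t then \<nu> n C else 0)"
        unfolding h_def
      proof (intro sum.cong refl)
        fix C assume "C \<in> Z n"
        then have "subgroup (coset_stab C \<inter> H) G"
          using Z(2)[of n] subgroup_coset_stab[OF L] H by (intro subgroups_Inter_pair) auto
        then show "\<nu> n C * indicator (A (coset_stab C)) H
            = (if averaging_bound S (l_coset G) (lcosets (coset_stab C \<inter> H)) t then \<nu> n C else 0)"
          using cospectral_radius_le_iff[OF S _ t] H by (simp add: A_def space indicator_def)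
      qed
      also have "\<dots> = (\<Sum>C | C \<in> Z n \<and> averaging_bound S (l_coset G) (lcosets (coset_stab C \<inter> H)) t. \<nu> n C)"
        using Z(1) by (simp add: sum.If_cases Int_def)
      also have "\<dots> \<le> K * inverse (Suc n)"
      proof (rule mass[rule_format])
        have "F \<subseteq> ?F n" using I(2) N n by fastforce
        then show "almost_invariant_measure L F (inverse (Suc n)) (Z n) (\<nu> n)"
          using Z\<nu>[of n] unfolding almost_invariant_measure_def by blast
      qed
      finally show ?thesis .
    qed
    show "(\<lambda>n. h n H) \<longlonglongrightarrow> 0"
    proof (rule tendsto_sandwich)
      show "\<forall>\<^sub>F n in sequentially. 0 \<le> h n H" using h_nonneg by simp
      show "\<forall>\<^sub>F n in sequentially. h n H \<le> K * inverse (Suc n)"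
        using bound by (auto simp: eventually_sequentially)
      show "(\<lambda>n. K * inverse (Suc n)) \<longlonglongrightarrow> 0"
        using tendsto_mult_left[OF LIMSEQ_inverse_real_of_nat, of K] by simp
    qed simp
  qed
  then have "(\<lambda>n. expectation (h n)) \<longlonglongrightarrow> expectation (\<lambda>_. 0)"
    using h_meas h_nonneg h_le by (intro integral_dominated_convergence[where w = "\<lambda>_. 1"]) auto
  then have "prob (A L) = 0"
    by (simp add: h_int LIMSEQ_const_iff)
  then have "AE H in \<mu>. H \<notin> A L" using prob_eq_0[OF A[OF L]] by simp
  then show ?thesis
    using AE_space by eventually_elim (auto simp: A_def)
qed

text \<open>
  Almost surely the radius of \<open>H2\<close> is a constant \<open>c\<close>. It bounds the radius of \<open>H1 \<inter> H2\<close> from above, and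
  every \<open>t < c\<close> bounds it from below.
\<close>
theorem theorem1p2:
  fixes G :: "('a, 'b) monoid_scheme" (structure)
    and S H1 :: "'a set"
    and P :: "'w measure"
    and H2 :: "'w \<Rightarrow> 'a set"
  assumes "group G" and "countable (carrier G)"
    and "finite_symmetric_subset G S"
    and "subgroup H1 G" and "coamenable G H1"
    and "ergodic_invariant_random_subgroup G P H2"
  shows "AE \<omega> in P. cospectral_radius G S (H1 \<inter> H2 \<omega>) = irs_cospectral_radius G S P H2"
proof -
  interpret group G by fact
  let ?\<mu> = "subgroup_law G P H2"
  let ?R = "cospectral_radius G S"
  have S: "finite S" "S \<noteq> {}" "S \<subseteq> carrier G"
    using assms(3) by (auto simp: finite_symmetric_subset_def)
  have P: "prob_space P" and H2: "H2 \<in> measurable P (subgroup_borel G)"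
    and inv: "conjugation_invariant_measure G ?\<mu>" and erg: "conjugation_ergodic_measure G ?\<mu>"
    using assms(6) by (auto simp: ergodic_invariant_random_subgroup_def invariant_random_subgroup_def)
  have \<mu>: "prob_space ?\<mu>" using prob_space.prob_space_distr[OF P H2] .
  have sets: "sets ?\<mu> = sets (subgroup_borel G)" by simp
  have "\<bar>?R H\<bar> \<le> 1" if "subgroup H G" for H
    using cospectral_radius_nonneg[OF S that] cospectral_radius_le_one[OF S that] by simp
  then obtain c where c: "AE H in ?\<mu>. ?R H = c"
    using ergodic_invariant_function_AE_constant[OF \<mu> sets erg measurable_cospectral_radius[OF S]]
      cospectral_radius_conjugate[OF S] by blast
  have cP: "AE \<omega> in P. ?R (H2 \<omega>) = c" using AE_distrD[OF H2 c] .
  have irs: "irs_cospectral_radius G S P H2 = c"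
    unfolding irs_cospectral_radius_def
  proof (rule the_equality)
    fix d assume "AE \<omega> in P. ?R (H2 \<omega>) = d"
    with cP have "AE \<omega> in P. d = c" by eventually_elim simp
    then show "d = c" using prob_space.AE_const[OF P] by simp
  qed (rule cP)
  have "AE H in ?\<mu>. c - inverse (Suc k) < ?R (H1 \<inter> H)" for k
  proof (rule AE_cospectral_radius_Int_gt[OF S assms(2,4,5) \<mu> sets inv])
    show "AE H in ?\<mu>. c - inverse (Suc k) < ?R H" using c by eventually_elim simp
  qed
  then have "AE H in ?\<mu>. \<forall>k. c - inverse (Suc k) < ?R (H1 \<inter> H)"
    by (simp add: AE_all_countable)
  then have "AE H in ?\<mu>. ?R (H1 \<inter> H) = c"
    using c AE_space
  proof eventually_elim
    fix H assume low: "\<forall>k. c - inverse (Suc k) < ?R (H1 \<inter> H)" and "?R H = c" and "H \<in> space ?\<mu>"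
    then have H: "subgroup H G" by (simp add: space_subgroup_borel)
    have "(\<lambda>k. c - inverse (Suc k)) \<longlonglongrightarrow> c - 0"
      by (intro tendsto_intros LIMSEQ_inverse_real_of_nat)
    then have "c - 0 \<le> ?R (H1 \<inter> H)"
      by (rule LIMSEQ_le_const2) (use low in \<open>auto intro: less_imp_le\<close>)
    moreover have "?R (H1 \<inter> H) \<le> ?R H"
      using subgroups_Inter_pair[OF assms(4) H] H by (intro cospectral_radius_mono[OF S]) auto
    ultimately show "?R (H1 \<inter> H) = c" using \<open>?R H = c\<close> by simp
  qed
  then show ?thesis unfolding irs by (rule AE_distrD[OF H2])
qed

end
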